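(* $\mathrm{PrCat}(\omega+\eta)=\mathrm{Cone}(\Delta^0_3)$.
   Context: $\omega+\eta$ is the linear order consisting of a copy of $\omega$ followed by a copy of $\eta$ (the order type of the rationals). A structure is punctual if its domain is $\omega$ and its relations are uniformly primitive recursive. For total $f,g:\omega\to\omega$, write $f\le_{PR}g$ if $f$ is primitive recursive relative to $g$; the induced equivalence classes are PR-degrees, and $f\le_{PR}\mathbf d$ means $f\le_{PR}$ a member of $\mathbf d$. For a punctual structure $A$, $\mathrm{PrCat}(A)$ is the set of PR-degrees $\mathbf d$ such that for every punctual $B\cong A$ there is an isomorphism $f:A\to B$ with $f\le_{PR}\mathbf d$ and $f^{-1}\le_{PR}\mathbf d$; for an isomorphism type $S$ with a punctual presentation, $\mathrm{PrCat}(S)$ means $\mathrm{PrCat}(A)$ for a punctual $A\cong S$ (independent of the choice of $A$). $\mathrm{Cone}(\Delta^0_3)$ is the set of PR-degrees $\mathbf d$ such that $f\le_{PR}\mathbf d$ for every total $\Delta^0_3$ function $f:\omega\to\omega$. *)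

theory Defs
  imports Complex_Main
begin

section \<open>Primitive recursive and recursive functions\<close>

text \<open>
  Functions of all arities are represented on argument lists, as in Szasz's treatment of the
  Ackermann function: a missing argument of a projection counts as 0. A function of arity \<open>k\<close> is
  (primitive) recursive iff it is the restriction of one of the list functions below to the lists
  of length \<open>k\<close>.
\<close>

definition proj :: "nat \<Rightarrow> nat list \<Rightarrow> nat" where
  "proj i xs = (if i < length xs then xs ! i else 0)"

definition comp_list :: "(nat list \<Rightarrow> nat) \<Rightarrow> (nat list \<Rightarrow> nat) list \<Rightarrow> nat list \<Rightarrow> nat" where
  "comp_list h fs xs = h (map (\<lambda>f. f xs) fs)"

text \<open>The recursion variable is the first argument; the step function receives the previous value,
  the current value of the recursion variable, and the parameters.\<close>

definition prec :: "(nat list \<Rightarrow> nat) \<Rightarrow> (nat list \<Rightarrow> nat) \<Rightarrow> nat list \<Rightarrow> nat" where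
  "prec b s xs = (case xs of [] \<Rightarrow> 0 | n # ps \<Rightarrow> rec_nat (b ps) (\<lambda>m r. s (r # m # ps)) n)"

inductive prim_rec_in :: "(nat \<Rightarrow> nat) set \<Rightarrow> (nat list \<Rightarrow> nat) \<Rightarrow> bool"
  for G :: "(nat \<Rightarrow> nat) set" where
  zero: "prim_rec_in G (\<lambda>_. 0)"
| suc: "prim_rec_in G (\<lambda>xs. Suc (proj 0 xs))"
| proj: "prim_rec_in G (proj i)"
| given: "g \<in> G \<Longrightarrow> prim_rec_in G (\<lambda>xs. g (proj 0 xs))"
| comp: "prim_rec_in G h \<Longrightarrow> (\<And>f. f \<in> set fs \<Longrightarrow> prim_rec_in G f) \<Longrightarrow> prim_rec_in G (comp_list h fs)"
| prec: "prim_rec_in G b \<Longrightarrow> prim_rec_in G s \<Longrightarrow> prim_rec_in G (prec b s)"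

text \<open>
  In the rule \<open>mu\<close>, regularity is required for argument lists of every length. This loses no
  function of a fixed arity: composing with projections makes a function that is regular on lists
  of one length regular everywhere.
\<close>

inductive recursive :: "(nat list \<Rightarrow> nat) \<Rightarrow> bool" where
  zero: "recursive (\<lambda>_. 0)"
| suc: "recursive (\<lambda>xs. Suc (proj 0 xs))"
| proj: "recursive (proj i)"
| comp: "recursive h \<Longrightarrow> (\<And>f. f \<in> set fs \<Longrightarrow> recursive f) \<Longrightarrow> recursive (comp_list h fs)"
| prec: "recursive b \<Longrightarrow> recursive s \<Longrightarrow> recursive (prec b s)"
| mu: "recursive f \<Longrightarrow> (\<And>xs. \<exists>y. f (y # xs) = 0) \<Longrightarrow> recursive (\<lambda>xs. LEAST y. f (y # xs) = 0)"


section \<open>PR-degrees\<close>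

text \<open>The parameter \<open>G\<close> of \<^const>\<open>prim_rec_in\<close> is the set of functions used as oracles: empty for absolute,
  a singleton for relative primitive recursiveness.\<close>

definition pr_le :: "(nat \<Rightarrow> nat) \<Rightarrow> (nat \<Rightarrow> nat) \<Rightarrow> bool" (infix "\<le>\<^sub>P\<^sub>R" 50) where
  "f \<le>\<^sub>P\<^sub>R g \<longleftrightarrow> (\<exists>h. prim_rec_in {g} h \<and> (\<forall>x. f x = h [x]))"

definition pr_equiv :: "((nat \<Rightarrow> nat) \<times> (nat \<Rightarrow> nat)) set" where
  "pr_equiv = {(f, g). f \<le>\<^sub>P\<^sub>R g \<and> g \<le>\<^sub>P\<^sub>R f}"

definition pr_degrees :: "(nat \<Rightarrow> nat) set set" where
  "pr_degrees = UNIV // pr_equiv"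

definition pr_le_degree :: "(nat \<Rightarrow> nat) \<Rightarrow> (nat \<Rightarrow> nat) set \<Rightarrow> bool" where
  "pr_le_degree f d \<longleftrightarrow> (\<exists>g\<in>d. f \<le>\<^sub>P\<^sub>R g)"

lemma pr_le_refl: "f \<le>\<^sub>P\<^sub>R f"
proof -
  have "prim_rec_in {f} (\<lambda>xs. f (proj 0 xs))"
    by (rule prim_rec_in.given) simp
  moreover have "\<forall>x. f x = f (proj 0 [x])"
    by (simp add: proj_def)
  ultimately show ?thesis
    unfolding pr_le_def by blast
qed

lemma prim_rec_in_pr_le:
  assumes "prim_rec_in {g} h" and "g \<le>\<^sub>P\<^sub>R k"
  shows "prim_rec_in {k} h"
  using assms(1)
proof induction
  case (given g')
  obtain h' where h': "prim_rec_in {k} h'" "\<And>x. g x = h' [x]"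
    using assms(2) by (auto simp: pr_le_def)
  have "prim_rec_in {k} (comp_list h' [proj 0])"
    using h'(1) by (intro prim_rec_in.comp) (auto intro: prim_rec_in.proj)
  moreover have "comp_list h' [proj 0] = (\<lambda>xs. g' (proj 0 xs))"
    using given h'(2) by (auto simp: comp_list_def)
  ultimately show ?case by simp
qed (auto intro: prim_rec_in.intros)

lemma pr_le_trans: "f \<le>\<^sub>P\<^sub>R g \<Longrightarrow> g \<le>\<^sub>P\<^sub>R k \<Longrightarrow> f \<le>\<^sub>P\<^sub>R k"
  using prim_rec_in_pr_le by (metis pr_le_def)

lemma equiv_pr_equiv: "equiv UNIV pr_equiv"
  by (rule equivI)
    (auto simp: pr_equiv_def refl_on_def sym_def trans_def intro: pr_le_refl pr_le_trans)


section \<open>The arithmetical hierarchy\<close>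

text \<open>
  \<open>sigma n k P\<close>: the restriction of \<open>P\<close> to lists of length \<open>k\<close> is a \<open>k\<close>-ary
  \<open>\<Sigma>\<^sup>0\<^sub>n\<close> relation. The relation \<open>Q\<close> below stands for the complement of the
  \<open>\<Pi>\<^sup>0\<^sub>n\<close> matrix.
\<close>

primrec sigma :: "nat \<Rightarrow> nat \<Rightarrow> (nat list \<Rightarrow> bool) \<Rightarrow> bool" where
  "sigma 0 k P \<longleftrightarrow> (\<exists>h. recursive h \<and> (\<forall>xs. length xs = k \<longrightarrow> h xs = of_bool (P xs)))"
| "sigma (Suc n) k P \<longleftrightarrow>
     (\<exists>Q. sigma n (Suc k) Q \<and> (\<forall>xs. length xs = k \<longrightarrow> P xs = (\<exists>y. \<not> Q (y # xs))))"

definition pi_rel :: "nat \<Rightarrow> nat \<Rightarrow> (nat list \<Rightarrow> bool) \<Rightarrow> bool" where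
  "pi_rel n k P \<longleftrightarrow> sigma n k (\<lambda>xs. \<not> P xs)"

definition delta :: "nat \<Rightarrow> nat \<Rightarrow> (nat list \<Rightarrow> bool) \<Rightarrow> bool" where
  "delta n k P \<longleftrightarrow> sigma n k P \<and> pi_rel n k P"

definition delta_fun :: "nat \<Rightarrow> (nat \<Rightarrow> nat) \<Rightarrow> bool" where
  "delta_fun n f \<longleftrightarrow> delta n 2 (\<lambda>xs. f (xs ! 0) = xs ! 1)"

definition Cone_Delta :: "nat \<Rightarrow> (nat \<Rightarrow> nat) set set" where
  "Cone_Delta n = {d \<in> pr_degrees. \<forall>f. delta_fun n f \<longrightarrow> pr_le_degree f d}"


section \<open>Punctual structures and punctual categoricity\<close>

text \<open>Structures with a single binary relation, given by that relation; the domain is the whole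
  type. For a single relation, uniform primitive recursiveness is primitive recursiveness.\<close>

definition punctual :: "(nat \<Rightarrow> nat \<Rightarrow> bool) \<Rightarrow> bool" where
  "punctual A \<longleftrightarrow> (\<exists>h. prim_rec_in {} h \<and> (\<forall>x y. h [x, y] = of_bool (A x y)))"

definition isomorphism :: "('a \<Rightarrow> 'a \<Rightarrow> bool) \<Rightarrow> ('b \<Rightarrow> 'b \<Rightarrow> bool) \<Rightarrow> ('a \<Rightarrow> 'b) \<Rightarrow> bool" where
  "isomorphism A B f \<longleftrightarrow> bij f \<and> (\<forall>x y. A x y \<longleftrightarrow> B (f x) (f y))"

definition isomorphic :: "('a \<Rightarrow> 'a \<Rightarrow> bool) \<Rightarrow> ('b \<Rightarrow> 'b \<Rightarrow> bool) \<Rightarrow> bool" (infix "\<cong>" 50) where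
  "A \<cong> B \<longleftrightarrow> (\<exists>f. isomorphism A B f)"

definition PrCat :: "(nat \<Rightarrow> nat \<Rightarrow> bool) \<Rightarrow> (nat \<Rightarrow> nat) set set" where
  "PrCat A = {d \<in> pr_degrees. \<forall>B. punctual B \<and> A \<cong> B \<longrightarrow>
     (\<exists>f. isomorphism A B f \<and> pr_le_degree f d \<and> pr_le_degree (inv f) d)}"

fun omega_plus_eta :: "nat + rat \<Rightarrow> nat + rat \<Rightarrow> bool" where
  "omega_plus_eta (Inl m) (Inl n) \<longleftrightarrow> m \<le> n"
| "omega_plus_eta (Inl m) (Inr q) \<longleftrightarrow> True"
| "omega_plus_eta (Inr p) (Inl n) \<longleftrightarrow> False"
| "omega_plus_eta (Inr p) (Inr q) \<longleftrightarrow> p \<le> q"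

end

theory Submission
  imports Defs "HOL-Library.Nat_Bijection" "HOL-Library.Countable_Set" "HOL-Library.Discrete_Functions"
begin

text \<open>
  Between two punctual copies of $\omega + \eta$ the $\omega$-parts are $\Sigma^0_2$, the position inside
  them is too, and on the $\eta$-parts Cantor's argument only asks $\Delta^0_3$ questions. Hence some
  isomorphism and its inverse are $\Delta^0_3$, and every degree above all $\Delta^0_3$ functions works.

  Conversely, write $f(n) = y$ for a $\Delta^0_3$ function as $\exists a \forall b \exists c\, Q$, and let a
  path descend the infinite binary tree, turning left at a node with $n$ left turns above it and $r$ right
  turns since the last of them if and only if $r$ codes $y$ and a witness $a$ for $f(n) = y$. This is a
  $\Pi^0_2$ condition on the node. One builds a punctual copy of $\omega + \eta$ from the nodes, in
  in-order, such that nodes left of the path have finite blocks and belong to $\omega$, while those to the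
  right have dense blocks and belong to $\eta$. A node enters only after all its ancestors. So any element
  of $\eta$ below the $n$-th left turn bounds the search for the next one, and an isomorphism with a
  decidable copy provides such elements and decides the $\eta$-part: it computes all left turns, hence
  $f$, primitive recursively.
\<close>


section \<open>Unary primitive recursive functions\<close>

text \<open>The obstacle in the converse is that primitive recursion has no unbounded search, while
  the next left turn of the path may be arbitrarily far away and no bound for it can be read off the
  tree. All information has to come out of the isomorphism, including the size of the search space.

  Coding the witness together with the value is what brings the condition at a node down from
  \<Sigma>-3 to \<Pi>-2, and a \<Pi>-2 condition can be approximated from one side: a left turn is
  confirmed for more and more numbers v, a right turn shows itself by the confirmations coming to an
  end.

  A punctual structure has no way to wait or to discard: every number is an element at once. Codes
  that fail the stage test therefore have to be put somewhere, and a dense region above everything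
  else absorbs them.

  Whether a block becomes finite or dense must be settled without knowing the path. For u left of
  the path there are only finitely many such nodes; for u right of it the path itself supplies
  arbitrarily large ones.\<close>

definition pr_fun :: "(nat \<Rightarrow> nat) set \<Rightarrow> (nat \<Rightarrow> nat) \<Rightarrow> bool" where
  "pr_fun G f \<longleftrightarrow> prim_rec_in G (\<lambda>xs. f (proj 0 xs))"

definition pr_pred :: "(nat \<Rightarrow> nat) set \<Rightarrow> (nat \<Rightarrow> bool) \<Rightarrow> bool" where
  "pr_pred G P \<longleftrightarrow> pr_fun G (\<lambda>x. of_bool (P x))"

lemma comp_list_eq: "comp_list h fs = (\<lambda>xs. h (map (\<lambda>f. f xs) fs))"
  by (simp add: comp_list_def fun_eq_iff)

lemma proj_Cons [simp]: "proj 0 (x # xs) = x" "proj (Suc i) (x # xs) = proj i xs"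
  by (simp_all add: proj_def)

lemma prim_rec_in_comp1:
  assumes "prim_rec_in G (\<lambda>xs. F (proj 0 xs))" "prim_rec_in G a"
  shows "prim_rec_in G (\<lambda>xs. F (a xs))"
  using prim_rec_in.comp[OF assms(1), of "[a]"] assms(2) by (simp add: comp_list_eq)

lemma prim_rec_in_comp2:
  assumes "prim_rec_in G (\<lambda>xs. F (proj 0 xs) (proj 1 xs))" "prim_rec_in G a" "prim_rec_in G b"
  shows "prim_rec_in G (\<lambda>xs. F (a xs) (b xs))"
proof -
  have "prim_rec_in G (comp_list (\<lambda>xs. F (proj 0 xs) (proj 1 xs)) [a, b])"
    using assms by (intro prim_rec_in.comp) auto
  then show ?thesis by (simp add: comp_list_eq)
qed

text \<open>\<open>prec\<close> takes its parameters as the tail of a list of any length. Composing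
  with two projections fixes one parameter, which suffices once tuples are coded as numbers.\<close>

lemma prim_rec_in_rec:
  assumes "prim_rec_in G (\<lambda>xs. b (proj 0 xs))"
    and "prim_rec_in G (\<lambda>xs. s (proj 0 xs) (proj 1 xs) (proj 2 xs))"
  shows "prim_rec_in G (\<lambda>xs. rec_nat (b (proj 1 xs)) (\<lambda>m r. s r m (proj 1 xs)) (proj 0 xs))"
proof -
  have "prim_rec_in G (comp_list (prec (\<lambda>xs. b (proj 0 xs)) (\<lambda>xs. s (proj 0 xs) (proj 1 xs) (proj 2 xs)))
      [proj 0, proj 1])"
    using assms by (intro prim_rec_in.comp prim_rec_in.prec) (auto intro: prim_rec_in.proj)
  then show ?thesis by (simp add: comp_list_eq prec_def numeral_2_eq_2)
qed

lemma prim_rec_in_const: "prim_rec_in G (\<lambda>_. c)"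
proof (induction c)
  case (Suc c)
  from prim_rec_in_comp1[OF prim_rec_in.suc this] show ?case by simp
qed (rule prim_rec_in.zero)

lemma prim_rec_in_Suc: "prim_rec_in G a \<Longrightarrow> prim_rec_in G (\<lambda>xs. Suc (a xs))"
  by (rule prim_rec_in_comp1[OF prim_rec_in.suc])

lemma prim_rec_in_add:
  assumes "prim_rec_in G a" "prim_rec_in G b"
  shows "prim_rec_in G (\<lambda>xs. a xs + b xs)"
proof -
  have eq: "rec_nat z (\<lambda>m r. Suc r) n = n + z" for z n :: nat
    by (induction n) auto
  have "prim_rec_in G (\<lambda>xs. proj 0 xs + proj 1 xs)"
    by (rule prim_rec_in_rec[of G "\<lambda>z. z" "\<lambda>r m z. Suc r", unfolded eq])
      (intro prim_rec_in.proj prim_rec_in_Suc)+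
  from prim_rec_in_comp2[OF this assms] show ?thesis .
qed

lemma prim_rec_in_mult:
  assumes "prim_rec_in G a" "prim_rec_in G b"
  shows "prim_rec_in G (\<lambda>xs. a xs * b xs)"
proof -
  have eq: "rec_nat 0 (\<lambda>m r. r + z) n = n * z" for z n :: nat
    by (induction n) auto
  have "prim_rec_in G (\<lambda>xs. proj 0 xs * proj 1 xs)"
    by (rule prim_rec_in_rec[of G "\<lambda>z. 0" "\<lambda>r m z. r + z", unfolded eq])
      (intro prim_rec_in.proj prim_rec_in.zero prim_rec_in_add)+
  from prim_rec_in_comp2[OF this assms] show ?thesis .
qed

lemma prim_rec_in_pred:
  assumes "prim_rec_in G a"
  shows "prim_rec_in G (\<lambda>xs. a xs - 1)"
proof -
  have eq: "rec_nat 0 (\<lambda>m r. m) n = n - 1" for n :: nat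
    by (cases n) auto
  have "prim_rec_in G (\<lambda>xs. proj 0 xs - 1)"
    by (rule prim_rec_in_rec[of G "\<lambda>z. 0" "\<lambda>r m z. m", unfolded eq])
      (intro prim_rec_in.proj prim_rec_in.zero)+
  from prim_rec_in_comp1[OF this assms] show ?thesis .
qed

lemma prim_rec_in_diff:
  assumes "prim_rec_in G a" "prim_rec_in G b"
  shows "prim_rec_in G (\<lambda>xs. a xs - b xs)"
proof -
  have eq: "rec_nat z (\<lambda>m r. r - 1) n = z - n" for z n :: nat
    by (induction n) auto
  have "prim_rec_in G (\<lambda>xs. proj 1 xs - proj 0 xs)"
    by (rule prim_rec_in_rec[of G "\<lambda>z. z" "\<lambda>r m z. r - 1", unfolded eq])
      (intro prim_rec_in.proj prim_rec_in_pred)+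
  from prim_rec_in_comp2[OF this assms(2,1)] show ?thesis .
qed

lemma prim_rec_in_if_zero:
  assumes "prim_rec_in G c" "prim_rec_in G a" "prim_rec_in G b"
  shows "prim_rec_in G (\<lambda>xs. if c xs = 0 then a xs else b xs)"
proof -
  have eq: "(if c xs = 0 then a xs else b xs) = a xs * (1 - c xs) + b xs * (1 - (1 - c xs))" for xs
    by simp
  show ?thesis unfolding eq
    by (intro prim_rec_in_add prim_rec_in_mult prim_rec_in_diff prim_rec_in_const assms)
qed

section \<open>Cantor's pairing function and its inverses\<close>

definition pair :: "nat \<Rightarrow> nat \<Rightarrow> nat" where "pair a b = prod_encode (a, b)"
definition pfst :: "nat \<Rightarrow> nat" where "pfst z = fst (prod_decode z)"
definition psnd :: "nat \<Rightarrow> nat" where "psnd z = snd (prod_decode z)"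

lemma pfst_pair [simp]: "pfst (pair a b) = a" by (simp add: pair_def pfst_def)
lemma psnd_pair [simp]: "psnd (pair a b) = b" by (simp add: pair_def psnd_def)
lemma pair_pfst_psnd [simp]: "pair (pfst z) (psnd z) = z" by (simp add: pair_def pfst_def psnd_def)
lemma pair_eq_iff [simp]: "pair a b = pair c d \<longleftrightarrow> a = c \<and> b = d" by (simp add: pair_def)

lemma prim_rec_in_triangle:
  assumes "prim_rec_in G a"
  shows "prim_rec_in G (\<lambda>xs. triangle (a xs))"
proof -
  have eq: "rec_nat 0 (\<lambda>m r. r + Suc m) n = triangle n" for n :: nat
    by (induction n) auto
  have "prim_rec_in G (\<lambda>xs. triangle (proj 0 xs))"
    by (rule prim_rec_in_rec[of G "\<lambda>z. 0" "\<lambda>r m z. r + Suc m", unfolded eq])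
      (intro prim_rec_in.proj prim_rec_in.zero prim_rec_in_add prim_rec_in_Suc)+
  from prim_rec_in_comp1[OF this assms] show ?thesis .
qed

text \<open>The largest r with \<open>triangle r \<le> z\<close>, by primitive recursion: r grows
  when the next triangular number is reached, truncated subtraction serving as the test. As
  \<open>pair a b\<close> lies between the triangular numbers of a + b and a + b + 1, the root
  recovers a + b, and with it both components.\<close>

definition triangle_root :: "nat \<Rightarrow> nat" where
  "triangle_root = rec_nat 0 (\<lambda>m r. if triangle (Suc r) - Suc m = 0 then Suc r else r)"

lemma triangle_root_bounds:
  "triangle (triangle_root z) \<le> z \<and> z < triangle (Suc (triangle_root z))"
  by (induction z) (auto simp: triangle_root_def)

lemma prim_rec_in_triangle_root:
  assumes "prim_rec_in G a"
  shows "prim_rec_in G (\<lambda>xs. triangle_root (a xs))"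
proof -
  have "prim_rec_in G (\<lambda>xs. triangle_root (proj 0 xs))"
    unfolding triangle_root_def
    by (rule prim_rec_in_rec[of G "\<lambda>z. 0" "\<lambda>r m z. if triangle (Suc r) - Suc m = 0 then Suc r else r"])
      (intro prim_rec_in.proj prim_rec_in.zero prim_rec_in_Suc prim_rec_in_diff
        prim_rec_in_if_zero prim_rec_in_triangle)+
  from prim_rec_in_comp1[OF this assms] show ?thesis .
qed

lemma triangle_mono: "a \<le> b \<Longrightarrow> triangle a \<le> triangle b"
  by (induction rule: dec_induct) auto

lemma triangle_root_unique:
  assumes "triangle k \<le> z" "z < triangle (Suc k)"
  shows "triangle_root z = k"
proof (rule antisym)
  show "triangle_root z \<le> k"
    using assms triangle_root_bounds[of z] triangle_mono[of "Suc k" "triangle_root z"] by (meson leD le_less_trans not_less_eq_eq)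
  show "k \<le> triangle_root z"
    using assms triangle_root_bounds[of z] triangle_mono[of "Suc (triangle_root z)" k] by (meson leD le_less_trans not_less_eq_eq)
qed

lemma triangle_root_pair: "triangle_root (pair a b) = a + b"
  by (rule triangle_root_unique) (auto simp: pair_def prod_encode_def)

lemma pfst_eq: "pfst z = z - triangle (triangle_root z)"
proof -
  have "pfst (pair a b) = pair a b - triangle (triangle_root (pair a b))" for a b
    unfolding triangle_root_pair by (simp add: pair_def pfst_def) (simp add: prod_encode_def)
  from this[of "pfst z" "psnd z"] show ?thesis by simp
qed

lemma psnd_eq: "psnd z = triangle_root z - pfst z"
  using triangle_root_pair[of "pfst z" "psnd z"] by simp

section \<open>Closure rules for unary functions and predicates\<close>

named_theorems pr_intros

lemma pr_fun_id [pr_intros]: "pr_fun G (\<lambda>x. x)"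
  unfolding pr_fun_def by (rule prim_rec_in.proj)

lemma pr_fun_const [pr_intros]: "pr_fun G (\<lambda>x. c)"
  unfolding pr_fun_def by (rule prim_rec_in_const)

lemma pr_fun_comp: "pr_fun G f \<Longrightarrow> pr_fun G a \<Longrightarrow> pr_fun G (\<lambda>x. f (a x))"
  unfolding pr_fun_def by (rule prim_rec_in_comp1)

lemma pr_fun_Suc [pr_intros]: "pr_fun G a \<Longrightarrow> pr_fun G (\<lambda>x. Suc (a x))"
  unfolding pr_fun_def by (rule prim_rec_in_Suc)

lemma pr_fun_add [pr_intros]: "pr_fun G a \<Longrightarrow> pr_fun G b \<Longrightarrow> pr_fun G (\<lambda>x. a x + b x)"
  unfolding pr_fun_def by (rule prim_rec_in_add)

lemma pr_fun_mult [pr_intros]: "pr_fun G a \<Longrightarrow> pr_fun G b \<Longrightarrow> pr_fun G (\<lambda>x. a x * b x)"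
  unfolding pr_fun_def by (rule prim_rec_in_mult)

lemma pr_fun_diff [pr_intros]: "pr_fun G a \<Longrightarrow> pr_fun G b \<Longrightarrow> pr_fun G (\<lambda>x. a x - b x)"
  unfolding pr_fun_def by (rule prim_rec_in_diff)

lemma pr_fun_pfst [pr_intros]: "pr_fun G a \<Longrightarrow> pr_fun G (\<lambda>x. pfst (a x))"
  unfolding pr_fun_def pfst_eq
  by (intro prim_rec_in_diff prim_rec_in_triangle prim_rec_in_triangle_root)

lemma pr_fun_psnd [pr_intros]: "pr_fun G a \<Longrightarrow> pr_fun G (\<lambda>x. psnd (a x))"
  using pr_fun_pfst[of G a] unfolding pr_fun_def psnd_eq
  by (intro prim_rec_in_diff prim_rec_in_triangle_root)

lemma prim_rec_in_pair:
  assumes "prim_rec_in G a" "prim_rec_in G b"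
  shows "prim_rec_in G (\<lambda>xs. pair (a xs) (b xs))"
  unfolding pair_def prod_encode_def prod.case
  by (intro prim_rec_in_add prim_rec_in_triangle assms)

lemma pr_fun_pair [pr_intros]: "pr_fun G a \<Longrightarrow> pr_fun G b \<Longrightarrow> pr_fun G (\<lambda>x. pair (a x) (b x))"
  unfolding pr_fun_def by (rule prim_rec_in_pair)

text \<open>Functions of several variables are replaced by unary ones on codes: counter, previous
  value and argument are projections of \<open>p\<close>. Thus the same rules apply again under the
  binder.\<close>

lemma pr_fun_rec [pr_intros]:
  assumes "pr_fun G b" "pr_fun G (\<lambda>p. s (pfst p) (pfst (psnd p)) (psnd (psnd p)))" "pr_fun G n"
  shows "pr_fun G (\<lambda>x. rec_nat (b x) (\<lambda>m r. s m r x) (n x))"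
proof -
  have "prim_rec_in G (\<lambda>xs. pair (proj 1 xs) (pair (proj 0 xs) (proj 2 xs)))"
    by (intro prim_rec_in_pair prim_rec_in.proj)
  from prim_rec_in_comp1[OF assms(2)[unfolded pr_fun_def] this]
  have "prim_rec_in G (\<lambda>xs. rec_nat (b (proj 1 xs)) (\<lambda>m r. s m r (proj 1 xs)) (proj 0 xs))"
    using prim_rec_in_rec[of G b "\<lambda>r m. s m r"] assms(1) by (simp add: pr_fun_def)
  from prim_rec_in_comp2[OF this, of "\<lambda>xs. n (proj 0 xs)" "proj 0"] show ?thesis
    using assms(3) by (simp add: pr_fun_def prim_rec_in.proj)
qed

lemma pr_fun_of_bool [pr_intros]: "pr_pred G P \<Longrightarrow> pr_fun G (\<lambda>x. of_bool (P x))"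
  by (simp add: pr_pred_def)

lemma pr_predI:
  assumes "pr_fun G f" and "\<And>x. P x \<longleftrightarrow> f x = 0"
  shows "pr_pred G P"
proof -
  have eq: "of_bool (P x) = 1 - f x" for x using assms(2)[of x] by simp
  show ?thesis unfolding pr_pred_def eq by (intro pr_intros assms(1))
qed

lemma pr_pred_const [pr_intros]: "pr_pred G (\<lambda>x. c)"
  unfolding pr_pred_def by (rule pr_fun_const)

lemma pr_pred_not [pr_intros]: "pr_pred G P \<Longrightarrow> pr_pred G (\<lambda>x. \<not> P x)"
  by (rule pr_predI[of G "\<lambda>x. of_bool (P x)"], (intro pr_intros; assumption), auto)

lemma pr_pred_le [pr_intros]: "pr_fun G a \<Longrightarrow> pr_fun G b \<Longrightarrow> pr_pred G (\<lambda>x. a x \<le> b x)"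
  by (rule pr_predI[of G "\<lambda>x. a x - b x"], (intro pr_intros; assumption), auto)

lemma pr_pred_less [pr_intros]: "pr_fun G a \<Longrightarrow> pr_fun G b \<Longrightarrow> pr_pred G (\<lambda>x. a x < b x)"
  by (rule pr_predI[of G "\<lambda>x. Suc (a x) - b x"], (intro pr_intros; assumption), auto)

lemma pr_pred_eq [pr_intros]: "pr_fun G a \<Longrightarrow> pr_fun G b \<Longrightarrow> pr_pred G (\<lambda>x. a x = b x)"
  by (rule pr_predI[of G "\<lambda>x. (a x - b x) + (b x - a x)"], (intro pr_intros; assumption), auto)

lemma pr_pred_disj [pr_intros]: "pr_pred G P \<Longrightarrow> pr_pred G Q \<Longrightarrow> pr_pred G (\<lambda>x. P x \<or> Q x)"
  by (rule pr_predI[of G "\<lambda>x. (1 - of_bool (P x)) * (1 - of_bool (Q x))"], (intro pr_intros; assumption), auto)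

lemma pr_pred_conj [pr_intros]:
  assumes "pr_pred G P" "pr_pred G Q"
  shows "pr_pred G (\<lambda>x. P x \<and> Q x)"
proof -
  have "pr_pred G (\<lambda>x. \<not> (\<not> P x \<or> \<not> Q x))" by (intro pr_pred_not pr_pred_disj assms)
  then show ?thesis by simp
qed

lemma pr_pred_imp [pr_intros]:
  assumes "pr_pred G P" "pr_pred G Q"
  shows "pr_pred G (\<lambda>x. P x \<longrightarrow> Q x)"
  unfolding imp_conv_disj by (intro pr_pred_not pr_pred_disj assms)

lemma pr_pred_iff [pr_intros]:
  assumes "pr_pred G P" "pr_pred G Q"
  shows "pr_pred G (\<lambda>x. P x \<longleftrightarrow> Q x)"
  unfolding iff_conv_conj_imp by (intro pr_pred_imp pr_pred_conj assms)

lemma pr_fun_if [pr_intros]: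
  assumes "pr_pred G P" "pr_fun G a" "pr_fun G b"
  shows "pr_fun G (\<lambda>x. if P x then a x else b x)"
proof -
  have eq: "(if P x then a x else b x) = a x * of_bool (P x) + b x * (1 - of_bool (P x))" for x
    by simp
  show ?thesis unfolding eq by (intro pr_intros assms)
qed

lemma pr_pred_comp: "pr_pred G P \<Longrightarrow> pr_fun G a \<Longrightarrow> pr_pred G (\<lambda>x. P (a x))"
  unfolding pr_pred_def by (rule pr_fun_comp)

section \<open>Bounded quantifiers, bounded search and arithmetic\<close>

lemma pr_fun_drop_second: "pr_fun G (\<lambda>p. pair (pfst p) (psnd (psnd p)))"
  by (intro pr_intros)

lemma pr_pred_ex_less [pr_intros]:
  assumes "pr_pred G (\<lambda>p. P (pfst p) (psnd p))" "pr_fun G n"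
  shows "pr_pred G (\<lambda>x. \<exists>i<n x. P i x)"
proof -
  have eq: "of_bool (\<exists>i<n. P i x) = rec_nat (0::nat) (\<lambda>m r. if P m x then Suc 0 else r) n" for n x
  proof (induction n)
    case (Suc n)
    show ?case by (auto simp: Suc.IH[symmetric] less_Suc_eq)
  qed simp
  have P: "pr_pred G (\<lambda>p. P (pfst p) (psnd (psnd p)))"
    using pr_pred_comp[OF assms(1) pr_fun_drop_second] by simp
  show ?thesis
    unfolding pr_pred_def eq by (intro pr_intros P assms)
qed

lemma pr_pred_all_less [pr_intros]:
  assumes "pr_pred G (\<lambda>p. P (pfst p) (psnd p))" "pr_fun G n"
  shows "pr_pred G (\<lambda>x. \<forall>i<n x. P i x)"
  using pr_pred_not[OF pr_pred_ex_less[OF pr_pred_not[OF assms(1)] assms(2)]] by simp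

lemma pr_pred_ex_le [pr_intros]:
  assumes "pr_pred G (\<lambda>p. P (pfst p) (psnd p))" "pr_fun G n"
  shows "pr_pred G (\<lambda>x. \<exists>i\<le>n x. P i x)"
  using pr_pred_ex_less[OF assms(1) pr_fun_Suc[OF assms(2)]] by (simp add: less_Suc_eq_le)

lemma pr_pred_all_le [pr_intros]:
  assumes "pr_pred G (\<lambda>p. P (pfst p) (psnd p))" "pr_fun G n"
  shows "pr_pred G (\<lambda>x. \<forall>i\<le>n x. P i x)"
  using pr_pred_all_less[OF assms(1) pr_fun_Suc[OF assms(2)]] by (simp add: less_Suc_eq_le)

text \<open>Search needs a bound \<open>n\<close> that is itself primitive recursive. Where the
  searched property gives no such bound, a default disjunct is built into it.\<close>

lemma pr_fun_Least:
  assumes "pr_pred G (\<lambda>p. P (pfst p) (psnd p))" "pr_fun G n" "\<And>x. \<exists>i\<le>n x. P i x"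
  shows "pr_fun G (\<lambda>x. LEAST i. P i x)"
proof -
  \<comment> \<open>Invariant: the least solution below n, or n itself if there is none. Hence
    \<open>r < m\<close> records that the search is over.\<close>
  define R where "R x n = rec_nat (0::nat) (\<lambda>m r. if r < m \<or> P m x then min r m else Suc m) n" for x n
  have R: "(\<forall>i<R x n. \<not> P i x) \<and> R x n \<le> n \<and> (R x n < n \<longrightarrow> P (R x n) x)" for x n
  proof (induction n)
    case (Suc n)
    have "R x (Suc n) = (if R x n < n \<or> P n x then min (R x n) n else Suc n)" by (simp add: R_def)
    with Suc show ?case by (auto simp: less_Suc_eq min_def)
  qed (simp add: R_def)
  have "(LEAST i. P i x) = R x (Suc (n x))" for x
  proof (rule Least_equality)
    from assms(3)[of x] obtain i where "i < Suc (n x)" "P i x" by (auto simp: less_Suc_eq_le)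
    with R[of x "Suc (n x)"] show "P (R x (Suc (n x))) x"
      by (metis le_less_trans linorder_neqE_nat nat_less_le)
    show "\<And>y. P y x \<Longrightarrow> R x (Suc (n x)) \<le> y" using R[of x "Suc (n x)"] not_le by blast
  qed
  moreover have "pr_fun G (\<lambda>x. R x (Suc (n x)))"
  proof -
    have "min a b = (if a \<le> b then a else b)" for a b :: nat by simp
    moreover have P: "pr_pred G (\<lambda>p. P (pfst p) (psnd (psnd p)))"
      using pr_pred_comp[OF assms(1) pr_fun_drop_second] by simp
    ultimately show ?thesis
      unfolding R_def by (simp only:) (intro pr_intros P assms)
  qed
  ultimately show ?thesis by simp
qed

lemma pr_fun_sum [pr_intros]:
  assumes "pr_fun G (\<lambda>p. F (pfst p) (psnd p))" "pr_fun G n"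
  shows "pr_fun G (\<lambda>x. \<Sum>i<n x. F i x)"
proof -
  have eq: "(\<Sum>i<n. F i x) = rec_nat 0 (\<lambda>m r. r + F m x) n" for n x
    by (induction n) auto
  have F: "pr_fun G (\<lambda>p. F (pfst p) (psnd (psnd p)))"
    using pr_fun_comp[OF assms(1) pr_fun_drop_second] by simp
  show ?thesis unfolding eq by (intro pr_intros F assms)
qed

lemma pr_fun_power [pr_intros]:
  assumes "pr_fun G a" "pr_fun G b"
  shows "pr_fun G (\<lambda>x. a x ^ b x)"
proof -
  have eq: "z ^ n = rec_nat 1 (\<lambda>m r. r * z) n" for z n :: nat
    by (induction n) auto
  have a: "pr_fun G (\<lambda>p. a (psnd (psnd p)))"
    by (intro pr_fun_comp[OF assms(1)] pr_intros)
  show ?thesis unfolding eq by (intro pr_intros a assms)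
qed

lemma pr_fun_div [pr_intros]:
  assumes "pr_fun G a" "pr_fun G b"
  shows "pr_fun G (\<lambda>x. a x div b x)"
proof -
  \<comment> \<open>The first disjunct accounts for division by 0, whose value is 0.\<close>
  have eq: "m div n = (LEAST q. n = 0 \<or> m < Suc q * n)" for m n :: nat
  proof (cases "n = 0")
    case False
    then show ?thesis
      by (intro Least_equality[symmetric])
        (use dividend_less_times_div[of n m] in \<open>auto simp: algebra_simps less_mult_imp_div_less le_less_Suc_eq
          less_Suc_eq_le[symmetric]\<close>)
  qed (simp add: Least_equality)
  have ab: "pr_fun G (\<lambda>p. a (psnd p))" "pr_fun G (\<lambda>p. b (psnd p))"
    by (intro pr_fun_comp[OF assms(1)] pr_fun_comp[OF assms(2)] pr_intros)+
  have "\<exists>i\<le>a x. b x = 0 \<or> a x < Suc i * b x" for x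
    by (rule exI[of _ "a x"]) (cases "b x", auto)
  then show ?thesis unfolding eq by (intro pr_fun_Least[where n = a] pr_intros ab assms)
qed

lemma pr_pred_even [pr_intros]: "pr_fun G a \<Longrightarrow> pr_pred G (\<lambda>x. even (a x))"
proof -
  assume "pr_fun G a"
  then have "pr_pred G (\<lambda>x. a x = 2 * (a x div 2))" by (intro pr_intros)
  then show ?thesis by (rule back_subst[of "pr_pred G"]) (metis dvd_triv_left even_two_times_div_two)
qed

section \<open>Oracles, degrees and punctual relations\<close>

lemma pr_fun_mono: "pr_fun G f \<Longrightarrow> G \<subseteq> H \<Longrightarrow> pr_fun H f"
proof -
  have "prim_rec_in G h \<Longrightarrow> G \<subseteq> H \<Longrightarrow> prim_rec_in H h" for h
    by (induction rule: prim_rec_in.induct) (auto intro: prim_rec_in.intros)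
  then show "pr_fun G f \<Longrightarrow> G \<subseteq> H \<Longrightarrow> pr_fun H f" by (simp add: pr_fun_def)
qed

lemma pr_pred_mono: "pr_pred G P \<Longrightarrow> G \<subseteq> H \<Longrightarrow> pr_pred H P"
  unfolding pr_pred_def by (rule pr_fun_mono)

lemma pr_le_iff_pr_fun: "f \<le>\<^sub>P\<^sub>R g \<longleftrightarrow> pr_fun {g} f"
proof
  assume "f \<le>\<^sub>P\<^sub>R g"
  then obtain h where "prim_rec_in {g} h" and h: "\<And>x. f x = h [x]" by (auto simp: pr_le_def)
  from this(1) have "prim_rec_in {g} (comp_list h [proj 0])"
    by (intro prim_rec_in.comp) (auto intro: prim_rec_in.proj)
  then show "pr_fun {g} f" by (simp add: pr_fun_def comp_list_eq h)
qed (auto simp: pr_le_def pr_fun_def proj_def)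

lemma punctual_iff: "punctual A \<longleftrightarrow> pr_pred {} (\<lambda>p. A (pfst p) (psnd p))"
proof
  assume "punctual A"
  then obtain h where "prim_rec_in {} h" and h: "\<And>x y. h [x, y] = of_bool (A x y)"
    by (auto simp: punctual_def)
  from this(1) have "prim_rec_in {} (comp_list h [\<lambda>xs. pfst (proj 0 xs), \<lambda>xs. psnd (proj 0 xs)])"
    using pr_fun_pfst[OF pr_fun_id, unfolded pr_fun_def] pr_fun_psnd[OF pr_fun_id, unfolded pr_fun_def]
    by (intro prim_rec_in.comp) auto
  then show "pr_pred {} (\<lambda>p. A (pfst p) (psnd p))"
    by (simp add: pr_pred_def pr_fun_def comp_list_eq h)
next
  assume A: "pr_pred {} (\<lambda>p. A (pfst p) (psnd p))"
  have "prim_rec_in {} (\<lambda>xs. pair (proj 0 xs) (proj 1 xs))"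
    by (intro prim_rec_in_pair prim_rec_in.proj)
  from prim_rec_in_comp1[OF A[unfolded pr_pred_def pr_fun_def] this]
  show "punctual A"
    unfolding punctual_def by (intro exI conjI) (auto simp: proj_def)
qed

lemma pr_pred_punctual:
  "punctual A \<Longrightarrow> pr_fun {} a \<Longrightarrow> pr_fun {} b \<Longrightarrow> pr_pred {} (\<lambda>x. A (a x) (b x))"
  using pr_pred_comp[of "{}" "\<lambda>p. A (pfst p) (psnd p)" "\<lambda>x. pair (a x) (b x)"]
  by (simp add: punctual_iff pr_fun_pair)


section \<open>Linear orders of type $\omega + \eta$ on the natural numbers\<close>

definition omega_part :: "('a \<Rightarrow> 'a \<Rightarrow> bool) \<Rightarrow> 'a set" where
  "omega_part A = {x. finite {y. A y x}}"

text \<open>An intrinsic description of the order type, with the \<omega>-part given by finiteness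
  of the set of predecessors. Whatever lies above a member of the \<eta>-part belongs to it again,
  so only the condition on smaller elements names the part in its conclusion.\<close>

locale omega_eta =
  fixes A :: "nat \<Rightarrow> nat \<Rightarrow> bool"
  assumes refl: "A x x"
    and trans: "A x y \<Longrightarrow> A y z \<Longrightarrow> A x z"
    and antisym: "A x y \<Longrightarrow> A y x \<Longrightarrow> x = y"
    and total: "A x y \<or> A y x"
    and infinite_omega_part: "infinite (omega_part A)"
    and eta_part_nonempty: "\<exists>x. x \<notin> omega_part A"
    and eta_part_dense: "x \<notin> omega_part A \<Longrightarrow> y \<notin> omega_part A \<Longrightarrow> A x y \<Longrightarrow> x \<noteq> y \<Longrightarrow>
      \<exists>z. A x z \<and> A z y \<and> z \<noteq> x \<and> z \<noteq> y"
    and eta_part_no_least: "x \<notin> omega_part A \<Longrightarrow> \<exists>y. y \<notin> omega_part A \<and> A y x \<and> y \<noteq> x"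
    and eta_part_no_greatest: "x \<notin> omega_part A \<Longrightarrow> \<exists>y. A x y \<and> y \<noteq> x"
begin

lemma omega_part_down: "x \<in> omega_part A \<Longrightarrow> A y x \<Longrightarrow> y \<in> omega_part A"
  unfolding omega_part_def mem_Collect_eq by (erule finite_subset[rotated]) (use trans in blast)

lemma omega_part_less: "x \<in> omega_part A \<Longrightarrow> y \<notin> omega_part A \<Longrightarrow> A x y \<and> \<not> A y x"
  using total omega_part_down by blast

lemma card_le_iff:
  assumes "x \<in> omega_part A" "y \<in> omega_part A"
  shows "A x y \<longleftrightarrow> card {z. A z x} \<le> card {z. A z y}"
proof
  show "A x y \<Longrightarrow> card {z. A z x} \<le> card {z. A z y}"
    using assms(2) trans by (intro card_mono) (auto simp: omega_part_def)
next
  assume le: "card {z. A z x} \<le> card {z. A z y}"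
  show "A x y"
  proof (rule ccontr)
    assume "\<not> A x y"
    then have "{z. A z y} \<subset> {z. A z x}"
      using total trans refl by blast
    then show False
      using assms(1) le psubset_card_mono[of "{z. A z x}" "{z. A z y}"] by (simp add: omega_part_def)
  qed
qed

lemma card_inj:
  "x \<in> omega_part A \<Longrightarrow> y \<in> omega_part A \<Longrightarrow> card {z. A z x} = card {z. A z y} \<Longrightarrow> x = y"
  using card_le_iff antisym by (metis order_refl)

text \<open>Pigeonhole: the predecessors of an element of position at least n have distinct
  positions between 1 and their number, so all of these occur. Positions start at 1 because an
  element is among its own predecessors.\<close>

lemma card_surj:
  assumes "n > 0"
  shows "\<exists>x\<in>omega_part A. card {z. A z x} = n"
proof -
  have inj: "inj_on (\<lambda>x. card {z. A z x}) (omega_part A)"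
    by (rule inj_onI) (rule card_inj)
  then have "infinite ((\<lambda>x. card {z. A z x}) ` omega_part A)"
    using infinite_omega_part finite_imageD by blast
  then obtain x where x: "x \<in> omega_part A" "n \<le> card {z. A z x}"
    by (metis (no_types, lifting) finite_nat_set_iff_bounded_le imageE linorder_linear)
  let ?D = "{z. A z x}"
  have D: "?D \<subseteq> omega_part A" "finite ?D"
    using x(1) omega_part_down by (auto simp: omega_part_def)
  have "card {z. A z y} \<in> {1..card ?D}" if "y \<in> ?D" for y
  proof -
    have "card {z. A z y} \<le> card ?D"
      using card_le_iff[of y x] that D(1) x(1) by auto
    moreover have "card {z. A z y} > 0"
      using that D(1) refl[of y] by (auto simp: omega_part_def card_gt_0_iff)
    ultimately show ?thesis by auto
  qed
  then have "(\<lambda>y. card {z. A z y}) ` ?D \<subseteq> {1..card ?D}" by blast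
  moreover have "card ((\<lambda>y. card {z. A z y}) ` ?D) = card {1..card ?D}"
    using card_image[OF inj_on_subset[OF inj D(1)]] by simp
  ultimately have "(\<lambda>y. card {z. A z y}) ` ?D = {1..card ?D}"
    by (intro card_subset_eq) auto
  moreover have "n \<in> {1..card ?D}" using assms x(2) by auto
  ultimately show ?thesis using D(1) by (metis (no_types, lifting) imageE subsetD)
qed

lemma finite_has_greatest:
  "finite L \<Longrightarrow> L \<noteq> {} \<Longrightarrow> \<exists>m\<in>L. \<forall>l\<in>L. A l m"
proof (induction L rule: finite_ne_induct)
  case (insert x F)
  then obtain m where "m \<in> F" "\<forall>l\<in>F. A l m" by blast
  with total[of x m] show ?case using trans refl by blast
qed (use refl in auto)

lemma finite_has_least:
  "finite L \<Longrightarrow> L \<noteq> {} \<Longrightarrow> \<exists>m\<in>L. \<forall>l\<in>L. A m l"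
proof (induction L rule: finite_ne_induct)
  case (insert x F)
  then obtain m where "m \<in> F" "\<forall>l\<in>F. A m l" by blast
  with total[of x m] show ?case using trans refl by blast
qed (use refl in auto)

text \<open>The extension step of Cantor's argument. According to which of \<open>L\<close> and
  \<open>U\<close> are empty, it rests on nonemptiness, on the missing endpoints or on
  density.\<close>

lemma eta_part_cut:
  assumes "finite L" "finite U" "L \<inter> omega_part A = {}" "U \<inter> omega_part A = {}"
    and "\<And>l u. l \<in> L \<Longrightarrow> u \<in> U \<Longrightarrow> \<not> A u l"
  shows "\<exists>y. y \<notin> omega_part A \<and> (\<forall>l\<in>L. \<not> A y l) \<and> (\<forall>u\<in>U. \<not> A u y)"
proof (cases "L = {}")
  case L: True
  show ?thesis
  proof (cases "U = {}")
    case True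
    with L eta_part_nonempty show ?thesis by auto
  next
    case False
    with finite_has_least[OF assms(2)] obtain u where u: "u \<in> U" "\<forall>v\<in>U. A u v" by blast
    then obtain y where y: "y \<notin> omega_part A" "A y u" "y \<noteq> u"
      using eta_part_no_least[of u] assms(4) by blast
    then have "\<not> A v y" if "v \<in> U" for v
      using that u(2) trans antisym by blast
    with y L show ?thesis by auto
  qed
next
  case False
  with finite_has_greatest[OF assms(1)] obtain l where l: "l \<in> L" "\<forall>k\<in>L. A k l" by blast
  have up: "y \<notin> omega_part A \<and> (\<forall>k\<in>L. \<not> A y k)" if "A l y" "y \<noteq> l" for y
    using that l assms(3) omega_part_down trans antisym by blast
  show ?thesis
  proof (cases "U = {}")
    case True
    with eta_part_no_greatest[of l] up l(1) assms(3) show ?thesis by blast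
  next
    case False
    with finite_has_least[OF assms(2)] obtain u where u: "u \<in> U" "\<forall>v\<in>U. A u v" by blast
    then have "A l u" "l \<noteq> u" using assms(5)[OF l(1) u(1)] total refl by blast+
    then obtain y where y: "A l y" "A y u" "y \<noteq> l" "y \<noteq> u"
      using eta_part_dense[of l u] l(1) u(1) assms(3,4) by blast
    then have "\<not> A v y" if "v \<in> U" for v
      using that u(2) trans antisym by blast
    with up y show ?thesis by blast
  qed
qed

end

section \<open>Cantor's argument for two copies\<close>

definition same_position :: "(nat \<Rightarrow> nat \<Rightarrow> bool) \<Rightarrow> (nat \<Rightarrow> nat \<Rightarrow> bool) \<Rightarrow> nat \<Rightarrow> nat \<Rightarrow> bool" where
  "same_position A B x y \<longleftrightarrow>
     x \<in> omega_part A \<and> y \<in> omega_part B \<and> card {z. A z x} = card {z. B z y}"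

text \<open>The map \<open>f\<close> is a parameter so that a coded finite sequence can stand in for
  \<open>forth\<close> when its graph is described arithmetically.\<close>

definition fits :: "(nat \<Rightarrow> nat \<Rightarrow> bool) \<Rightarrow> (nat \<Rightarrow> nat \<Rightarrow> bool) \<Rightarrow> (nat \<Rightarrow> nat) \<Rightarrow> nat \<Rightarrow> nat \<Rightarrow> bool" where
  "fits A B f x y \<longleftrightarrow> same_position A B x y \<or>
     x \<notin> omega_part A \<and> y \<notin> omega_part B \<and>
     (\<forall>i<x. i \<notin> omega_part A \<longrightarrow> (A i x \<longleftrightarrow> B (f i) y) \<and> (A x i \<longleftrightarrow> B y (f i)))"

text \<open>Only the ``forth'' half of Cantor's back-and-forth argument is carried out: on dense orders, always
  choosing the least suitable image yields a surjective map.\<close>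

fun forth :: "(nat \<Rightarrow> nat \<Rightarrow> bool) \<Rightarrow> (nat \<Rightarrow> nat \<Rightarrow> bool) \<Rightarrow> nat \<Rightarrow> nat" where
  "forth A B x = (LEAST y. same_position A B x y \<or>
     x \<notin> omega_part A \<and> y \<notin> omega_part B \<and>
     (\<forall>i<x. i \<notin> omega_part A \<longrightarrow>
       (A i x \<longleftrightarrow> B (forth A B i) y) \<and> (A x i \<longleftrightarrow> B y (forth A B i))))"

declare forth.simps [simp del]

lemma forth_eq: "forth A B x = (LEAST y. fits A B (forth A B) x y)"
  unfolding fits_def by (rule forth.simps)

locale omega_eta_pair = A: omega_eta A + B: omega_eta B for A B
begin

lemma fits_forth: "fits A B (forth A B) x (forth A B x)"
proof (induction x rule: less_induct)
  case (less x)
  have "\<exists>y. fits A B (forth A B) x y"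
  proof (cases "x \<in> omega_part A")
    case True
    then have "card {z. A z x} > 0" using A.refl by (auto simp: omega_part_def card_gt_0_iff)
    with B.card_surj[of "card {z. A z x}"] True show ?thesis
      by (auto simp: fits_def same_position_def)
  next
    case False
    define S where "S = {i. i < x \<and> i \<notin> omega_part A}"
    have S: "finite S" by (simp add: S_def)
    have eta: "forth A B i \<notin> omega_part B" if "i \<in> S" for i
      using less.IH[of i] that by (auto simp: fits_def S_def same_position_def)
    \<comment> \<open>The condition met by the later of two arguments already compares it with the
      earlier one; hence the split on their numerical order.\<close>
    have lt: "A i j \<longleftrightarrow> B (forth A B i) (forth A B j)" if "i \<in> S" "j \<in> S" for i j
      using less.IH[of i] less.IH[of j] that A.refl B.refl linorder_neqE_nat[of i j thesis]
      by (cases i j rule: linorder_cases) (auto simp: fits_def S_def same_position_def)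
    define L where "L = forth A B ` {i\<in>S. A i x}"
    define U where "U = forth A B ` {i\<in>S. A x i}"
    have "\<exists>y. y \<notin> omega_part B \<and> (\<forall>l\<in>L. \<not> B y l) \<and> (\<forall>u\<in>U. \<not> B u y)"
    proof (rule B.eta_part_cut)
      show "\<not> B u l" if lu: "l \<in> L" "u \<in> U" for l u
      proof
        assume "B u l"
        from lu obtain i j where ij: "i \<in> S" "A i x" "l = forth A B i" "j \<in> S" "A x j" "u = forth A B j"
          by (auto simp: L_def U_def)
        with lt \<open>B u l\<close> have "A j i" by blast
        with ij A.trans A.antisym have "i = x" by blast
        with ij show False by (simp add: S_def)
      qed
    qed (use S eta in \<open>auto simp: L_def U_def\<close>)
    then obtain y where y: "y \<notin> omega_part B" "\<forall>l\<in>L. \<not> B y l" "\<forall>u\<in>U. \<not> B u y" by blast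
    have "(A i x \<longleftrightarrow> B (forth A B i) y) \<and> (A x i \<longleftrightarrow> B y (forth A B i))"
      if i: "i < x" "i \<notin> omega_part A" for i
    proof -
      have iS: "i \<in> S" using i by (simp add: S_def)
      have excl: "\<not> (A i x \<and> A x i)" using i(1) A.antisym by blast
      show ?thesis
      proof (cases "A i x")
        case True
        then have "\<not> B y (forth A B i)" using y(2) iS by (auto simp: L_def)
        then show ?thesis using True excl B.total by blast
      next
        case False
        then have "A x i" using A.total by blast
        then have "\<not> B (forth A B i) y" using y(3) iS by (auto simp: U_def)
        then show ?thesis using False \<open>A x i\<close> B.total by blast
      qed
    qed
    with y(1) False show ?thesis by (auto simp: fits_def)
  qed
  then show ?case unfolding forth_eq[of A B x] by (rule LeastI_ex)
qed

lemma forth_omega_part: "forth A B x \<in> omega_part B \<longleftrightarrow> x \<in> omega_part A"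
  using fits_forth[of x] by (auto simp: fits_def same_position_def)

lemma forth_mono: "A x y \<longleftrightarrow> B (forth A B x) (forth A B y)"
proof (cases "x \<in> omega_part A"; cases "y \<in> omega_part A")
  assume xy: "x \<in> omega_part A" "y \<in> omega_part A"
  then have "card {z. A z x} = card {z. B z (forth A B x)}" "card {z. A z y} = card {z. B z (forth A B y)}"
    using fits_forth[of x] fits_forth[of y] by (auto simp: fits_def same_position_def)
  with xy show ?thesis
    by (simp add: A.card_le_iff B.card_le_iff forth_omega_part)
next
  assume "x \<notin> omega_part A" "y \<notin> omega_part A"
  then show ?thesis
    using fits_forth[of x] fits_forth[of y] A.refl B.refl
    by (cases x y rule: linorder_cases) (auto simp: fits_def same_position_def)
next
  assume "x \<in> omega_part A" "y \<notin> omega_part A"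
  then show ?thesis using A.omega_part_less B.omega_part_less forth_omega_part by blast
next
  assume "x \<notin> omega_part A" "y \<in> omega_part A"
  then show ?thesis using A.omega_part_less B.omega_part_less forth_omega_part by blast
qed

lemma inj_forth: "inj (forth A B)"
proof (rule injI)
  fix x y assume "forth A B x = forth A B y"
  then have "A x y" "A y x" using forth_mono[of x y] forth_mono[of y x] B.refl by auto
  then show "x = y" by (rule A.antisym)
qed

lemma surj_forth: "\<exists>x. forth A B x = y"
proof (cases "y \<in> omega_part B")
  case True
  then have "card {z. B z y} > 0" using B.refl by (auto simp: omega_part_def card_gt_0_iff)
  then obtain x where x: "x \<in> omega_part A" "card {z. A z x} = card {z. B z y}"
    using A.card_surj by blast
  with fits_forth[of x] have "card {z. B z (forth A B x)} = card {z. B z y}"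
    by (auto simp: fits_def same_position_def)
  with B.card_inj True x(1) forth_omega_part show ?thesis by blast
next
  case False
  then show ?thesis
  proof (induction y rule: less_induct)
    case (less y)
    show ?case
    proof (rule ccontr)
      assume nohit: "\<not> ?case"
      have "\<exists>N. \<forall>y'<m. y' \<notin> omega_part B \<longrightarrow> (\<exists>x<N. forth A B x = y')" if "m \<le> y" for m
        using that
      proof (induction m)
        case (Suc m)
        then obtain N where N: "\<forall>y'<m. y' \<notin> omega_part B \<longrightarrow> (\<exists>x<N. forth A B x = y')" by auto
        from Suc.prems less.IH[of m] obtain x where "m \<notin> omega_part B \<longrightarrow> forth A B x = m" by auto
        with N show ?case
          by (intro exI[of _ "max N (Suc x)"]) (auto simp: less_Suc_eq less_max_iff_disj)
      qed simp
      then obtain N where N: "\<And>y'. y' < y \<Longrightarrow> y' \<notin> omega_part B \<Longrightarrow> \<exists>x<N. forth A B x = y'" by blast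
      define S where "S = {i. i < N \<and> i \<notin> omega_part A}"
      define L where "L = {i\<in>S. B (forth A B i) y}"
      define U where "U = {i\<in>S. B y (forth A B i)}"
      have LU: "S = L \<union> U" using B.total by (auto simp: L_def U_def)
      \<comment> \<open>The elements of the cut: they lie to the arguments below N as y lies to
        their images.\<close>
      define P where "P x \<longleftrightarrow> x \<notin> omega_part A \<and> (\<forall>l\<in>L. \<not> A x l) \<and> (\<forall>u\<in>U. \<not> A u x)" for x
      have "\<exists>x. P x" unfolding P_def
      proof (rule A.eta_part_cut)
        show "\<not> A u l" if lu: "l \<in> L" "u \<in> U" for l u
        proof
          assume "A u l"
          then have "B (forth A B u) (forth A B l)" using forth_mono by blast
          with lu have "B y (forth A B l)" "B (forth A B l) y"
            by (auto simp: L_def U_def intro: B.trans)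
          then have "forth A B l = y" by (rule B.antisym[rotated])
          with nohit show False by blast
        qed
      qed (auto simp: L_def U_def S_def)
      then have "P (LEAST x. P x)" by (rule LeastI_ex)
      then obtain x where "P x" and "\<And>i. i < x \<Longrightarrow> \<not> P i" using not_less_Least by blast
      then have x: "x \<notin> omega_part A" "\<And>l. l \<in> L \<Longrightarrow> \<not> A x l" "\<And>u. u \<in> U \<Longrightarrow> \<not> A u x"
        and min: "\<And>i. i < x \<Longrightarrow> i \<notin> omega_part A \<Longrightarrow> (\<exists>l\<in>L. A i l) \<or> (\<exists>u\<in>U. A u i)"
        unfolding P_def by blast+
      have "N \<le> x"
      proof (rule ccontr)
        assume "\<not> N \<le> x"
        with x have "x \<in> S" by (simp add: S_def)
        with LU x A.refl show False by blast
      qed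
      have "(A i x \<longleftrightarrow> B (forth A B i) y) \<and> (A x i \<longleftrightarrow> B y (forth A B i))"
        if i: "i < x" "i \<notin> omega_part A" for i
      proof -
        from min[OF i] consider (low) l where "l \<in> L" "A i l" | (high) u where "u \<in> U" "A u i"
          by blast
        then show ?thesis
        proof cases
          case low
          then have "B (forth A B i) y" using forth_mono[of i l] B.trans by (auto simp: L_def)
          then have "\<not> B y (forth A B i)" using nohit B.antisym by blast
          moreover have "A i x" "\<not> A x i" using low x A.total A.trans by blast+
          ultimately show ?thesis using \<open>B (forth A B i) y\<close> by blast
        next
          case high
          then have "B y (forth A B i)" using forth_mono[of u i] B.trans by (auto simp: U_def)
          then have "\<not> B (forth A B i) y" using nohit B.antisym by blast
          moreover have "A x i" "\<not> A i x" using high x A.total A.trans by blast+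
          ultimately show ?thesis using \<open>B y (forth A B i)\<close> by blast
        qed
      qed
      with x less.prems have "fits A B (forth A B) x y" by (auto simp: fits_def)
      then have "forth A B x \<le> y" unfolding forth_eq[of A B x] by (rule Least_le)
      moreover have "forth A B x \<noteq> y" using nohit by blast
      ultimately obtain x' where "x' < N" "forth A B x' = forth A B x"
        using N[of "forth A B x"] x forth_omega_part by auto
      then have "x' = x" using injD[OF inj_forth] by blast
      with \<open>x' < N\<close> \<open>N \<le> x\<close> show False by simp
    qed
  qed
qed

lemma isomorphism_forth: "isomorphism A B (forth A B)"
  unfolding isomorphism_def
proof (intro conjI allI)
  show "bij (forth A B)" unfolding bij_def surj_def using inj_forth surj_forth by (auto intro: sym)
qed (rule forth_mono)

end

section \<open>Copies of \<omega> + \<eta> up to isomorphism\<close>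

lemma isomorphism_comp:
  "isomorphism A B f \<Longrightarrow> isomorphism B C g \<Longrightarrow> isomorphism A C (g \<circ> f)"
  by (simp add: isomorphism_def bij_comp)

lemma isomorphism_inv: "isomorphism A B f \<Longrightarrow> isomorphism B A (inv f)"
  unfolding isomorphism_def by (simp add: bij_imp_bij_inv) (metis bij_inv_eq_iff)

lemma isomorphism_omega_part:
  assumes "isomorphism A B f"
  shows "f x \<in> omega_part B \<longleftrightarrow> x \<in> omega_part A"
proof -
  have "{y. B y (f x)} = f ` {y. A y x}"
    using assms by (auto simp: isomorphism_def image_iff) (metis bij_pointE)
  then show ?thesis
    using assms by (auto simp: omega_part_def isomorphism_def bij_def finite_image_iff inj_on_subset)
qed

lemma omega_part_omega_plus_eta: "omega_part omega_plus_eta = range Inl"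
proof -
  have "{y. omega_plus_eta y (Inl n)} = Inl ` {..n}" for n
  proof -
    have "omega_plus_eta y (Inl n) \<longleftrightarrow> y \<in> Inl ` {..n}" for y
      by (cases y) auto
    then show ?thesis by auto
  qed
  moreover have "infinite {y. omega_plus_eta y (Inr q)}" for q
  proof
    assume "finite {y. omega_plus_eta y (Inr q)}"
    then have "finite (range Inl :: (nat + rat) set)"
      by (rule finite_subset[rotated]) auto
    then show False using finite_imageD[of Inl "UNIV :: nat set"] by (simp add: inj_def)
  qed
  moreover have "x \<in> range Inl" if "finite {y. omega_plus_eta y x}" for x :: "nat + rat"
    using that calculation(2) by (cases x) auto
  ultimately show ?thesis unfolding omega_part_def
    by (auto simp del: omega_plus_eta.simps)
qed

lemma omega_eta_if_isomorphic:
  assumes "A \<cong> omega_plus_eta"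
  shows "omega_eta A"
proof -
  obtain f where iso: "isomorphism A omega_plus_eta f" using assms by (auto simp: isomorphic_def)
  then have A: "A x y \<longleftrightarrow> omega_plus_eta (f x) (f y)" for x y by (simp add: isomorphism_def)
  have bij: "bij f" using iso by (simp add: isomorphism_def)
  then have surj: "\<exists>x. f x = s" for s by (metis bij_pointE)
  have inj: "f x = f y \<longleftrightarrow> x = y" for x y using bij by (metis bij_pointE)
  have W: "x \<in> omega_part A \<longleftrightarrow> (\<exists>n. f x = Inl n)" for x
    using isomorphism_omega_part[OF iso, of x] by (auto simp: omega_part_omega_plus_eta)
  have W': "x \<notin> omega_part A \<longleftrightarrow> (\<exists>q. f x = Inr q)" for x
    unfolding W by (cases "f x") auto
  show ?thesis
  proof
    show "A x x" for x unfolding A by (cases "f x") auto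
    show "A x z" if "A x y" "A y z" for x y z
      using that unfolding A by (cases "f x"; cases "f y"; cases "f z") auto
    show "x = y" if "A x y" "A y x" for x y
      using that unfolding A inj[symmetric] by (cases "f x"; cases "f y") auto
    show "A x y \<or> A y x" for x y unfolding A by (cases "f x"; cases "f y") auto
    show "infinite (omega_part A)"
    proof
      assume "finite (omega_part A)"
      moreover have "range Inl \<subseteq> f ` omega_part A" using surj W by (metis image_iff image_subsetI)
      ultimately have "finite (range Inl :: (nat + rat) set)" by (meson finite_imageI finite_subset)
      then show False using finite_imageD[of Inl "UNIV :: nat set"] by (simp add: inj_def)
    qed
    show "\<exists>x. x \<notin> omega_part A" using surj W' by metis
    fix x assume "x \<notin> omega_part A"
    then obtain p where p: "f x = Inr p" using W' by blast
    obtain y where "f y = Inr (p - 1)" using surj by blast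
    then show "\<exists>y. y \<notin> omega_part A \<and> A y x \<and> y \<noteq> x"
      using p W' by (intro exI[of _ y]) (auto simp: A inj[symmetric])
    obtain z where "f z = Inr (p + 1)" using surj by blast
    then show "\<exists>y. A x y \<and> y \<noteq> x"
      using p by (intro exI[of _ z]) (auto simp: A inj[symmetric])
    fix y assume "y \<notin> omega_part A" and xy: "A x y" "x \<noteq> y"
    then obtain q where q: "f y = Inr q" using W' by blast
    with xy p have "p < q" by (auto simp: A inj[symmetric])
    then obtain r where r: "p < r" "r < q" using dense by blast
    obtain w where "f w = Inr r" using surj by blast
    with p q r show "\<exists>z. A x z \<and> A z y \<and> z \<noteq> x \<and> z \<noteq> y"
      by (intro exI[of _ w]) (auto simp: A inj[symmetric])
  qed
qed

text \<open>\<open>omega_eta_pair\<close> compares two orders on the natural numbers, so the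
  standard order is first transported there along a bijection.\<close>

lemma isomorphic_omega_plus_eta_iff: "A \<cong> omega_plus_eta \<longleftrightarrow> omega_eta A"
proof
  assume A: "omega_eta A"
  obtain g :: "nat + rat \<Rightarrow> nat" where "bij g"
    using countableE_infinite[of "UNIV :: (nat + rat) set"] by (auto simp: finite_Plus_UNIV_iff infinite_UNIV_char_0)
  define C where "C x y = omega_plus_eta (inv g x) (inv g y)" for x y
  have C: "isomorphism C omega_plus_eta (inv g)"
    using \<open>bij g\<close> by (simp add: isomorphism_def C_def bij_imp_bij_inv)
  then have "omega_eta C" by (intro omega_eta_if_isomorphic) (auto simp: isomorphic_def)
  with A interpret omega_eta_pair A C by (rule omega_eta_pair.intro)
  show "A \<cong> omega_plus_eta"
    using isomorphism_comp[OF isomorphism_forth C] by (auto simp: isomorphic_def)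
qed (rule omega_eta_if_isomorphic)


section \<open>The arithmetical hierarchy with primitive recursive matrices\<close>

text \<open>A variant of \<open>sigma\<close> on codes with primitive recursive matrices, to which
  the rules of \<open>pr_intros\<close> apply. From level 1 on it describes the same relations;
  level 0 has primitive recursive predicates in place of recursive ones.\<close>

primrec sigma_pr :: "nat \<Rightarrow> (nat \<Rightarrow> bool) \<Rightarrow> bool" where
  "sigma_pr 0 P \<longleftrightarrow> pr_pred {} P"
| "sigma_pr (Suc n) P \<longleftrightarrow> (\<exists>Q. sigma_pr n Q \<and> (\<forall>x. P x \<longleftrightarrow> (\<exists>y. \<not> Q (pair y x))))"

definition delta_pr :: "nat \<Rightarrow> (nat \<Rightarrow> bool) \<Rightarrow> bool" where
  "delta_pr n P \<longleftrightarrow> sigma_pr n P \<and> sigma_pr n (\<lambda>x. \<not> P x)"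

lemma sigma_pr_subst: "sigma_pr n P \<Longrightarrow> pr_fun {} a \<Longrightarrow> sigma_pr n (\<lambda>x. P (a x))"
proof (induction n arbitrary: P a)
  case (Suc n)
  then obtain Q where Q: "sigma_pr n Q" "\<And>x. P x \<longleftrightarrow> (\<exists>y. \<not> Q (pair y x))" by auto
  have "pr_fun {} (\<lambda>p. pair (pfst p) (a (psnd p)))"
    by (intro pr_intros pr_fun_comp[OF Suc.prems(2)])
  from Suc.IH[OF Q(1) this] Q(2) show ?case
    unfolding sigma_pr.simps by (intro exI[of _ "\<lambda>p. Q (pair (pfst p) (a (psnd p)))"]) simp
qed (simp add: pr_pred_comp)

lemma sigma_pr_pr: "pr_pred {} P \<Longrightarrow> sigma_pr n P"
proof (induction n arbitrary: P)
  case (Suc n)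
  have "pr_pred {} (\<lambda>p. \<not> P (psnd p))"
    by (intro pr_intros pr_pred_comp[OF Suc.prems])
  from Suc.IH[OF this] show ?case
    unfolding sigma_pr.simps by (intro exI[of _ "\<lambda>p. \<not> P (psnd p)"]) simp
qed simp

lemma sigma_pr_Suc_not:
  assumes "sigma_pr n (\<lambda>x. \<not> P x)"
  shows "sigma_pr (Suc n) P"
proof -
  have "pr_fun {} psnd" using pr_fun_psnd[OF pr_fun_id] .
  from sigma_pr_subst[OF assms this] show ?thesis
    unfolding sigma_pr.simps by (intro exI[of _ "\<lambda>p. \<not> P (psnd p)"]) simp
qed

lemma sigma_pr_Suc: "sigma_pr n P \<Longrightarrow> sigma_pr (Suc n) P"
proof (induction n arbitrary: P)
  case 0
  then show ?case by (intro sigma_pr_pr) simp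
next
  case (Suc n)
  then obtain Q where Q: "sigma_pr n Q" "\<forall>x. P x \<longleftrightarrow> (\<exists>y. \<not> Q (pair y x))" by auto
  with Suc.IH[OF Q(1)] show ?case unfolding sigma_pr.simps(2)[of "Suc n"] by blast
qed

lemma sigma_pr_ex:
  assumes "sigma_pr (Suc n) (\<lambda>p. P (pfst p) (psnd p))"
  shows "sigma_pr (Suc n) (\<lambda>x. \<exists>y. P y x)"
proof -
  obtain Q where Q: "sigma_pr n Q" "\<And>p. P (pfst p) (psnd p) \<longleftrightarrow> (\<exists>y. \<not> Q (pair y p))"
    using assms by auto
  have P: "P y x \<longleftrightarrow> (\<exists>z. \<not> Q (pair z (pair y x)))" for x y
    using Q(2)[of "pair y x"] by simp
  have "pr_fun {} (\<lambda>q. pair (psnd (pfst q)) (pair (pfst (pfst q)) (psnd q)))"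
    by (intro pr_intros)
  from sigma_pr_subst[OF Q(1) this]
  have "sigma_pr n (\<lambda>q. Q (pair (psnd (pfst q)) (pair (pfst (pfst q)) (psnd q))))" .
  moreover have "(\<exists>y. P y x) \<longleftrightarrow> (\<exists>z. \<not> Q (pair (psnd z) (pair (pfst z) x)))" for x
    unfolding P by (metis pfst_pair psnd_pair)
  ultimately show ?thesis
    unfolding sigma_pr.simps by (intro exI[of _ "\<lambda>q. Q (pair (psnd (pfst q)) (pair (pfst (pfst q)) (psnd q)))"]) simp
qed

text \<open>Both connectives go through one induction, because \<open>Q\<close> stands for a
  complement and each level exchanges them. The two witnesses become the components of one
  pair.\<close>

lemma sigma_pr_conj_disj:
  "sigma_pr n P \<Longrightarrow> sigma_pr n P' \<Longrightarrow> sigma_pr n (\<lambda>x. P x \<and> P' x) \<and> sigma_pr n (\<lambda>x. P x \<or> P' x)"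
proof (induction n arbitrary: P P')
  case 0
  then show ?case by (auto intro: pr_pred_conj pr_pred_disj)
next
  case (Suc n)
  then obtain Q Q' where Q: "sigma_pr n Q" "\<And>x. P x \<longleftrightarrow> (\<exists>y. \<not> Q (pair y x))"
    and Q': "sigma_pr n Q'" "\<And>x. P' x \<longleftrightarrow> (\<exists>y. \<not> Q' (pair y x))" by auto
  have fg: "pr_fun {} (\<lambda>p. pair (pfst (pfst p)) (psnd p))" "pr_fun {} (\<lambda>p. pair (psnd (pfst p)) (psnd p))"
    by (intro pr_intros)+
  note QQ = Suc.IH[OF sigma_pr_subst[OF Q(1) fg(1)] sigma_pr_subst[OF Q'(1) fg(2)]]
  have "(P x \<and> P' x) \<longleftrightarrow> (\<exists>y. \<not> (Q (pair (pfst y) x) \<or> Q' (pair (psnd y) x)))" for x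
    unfolding Q(2) Q'(2) by (metis pfst_pair psnd_pair)
  moreover have "(P x \<or> P' x) \<longleftrightarrow> (\<exists>y. \<not> (Q (pair (pfst y) x) \<and> Q' (pair (psnd y) x)))" for x
    unfolding Q(2) Q'(2) by (metis pfst_pair psnd_pair)
  ultimately show ?case
    unfolding sigma_pr.simps using QQ
    by (intro conjI exI[of _ "\<lambda>p. Q (pair (pfst (pfst p)) (psnd p)) \<or> Q' (pair (psnd (pfst p)) (psnd p))"]
        exI[of _ "\<lambda>p. Q (pair (pfst (pfst p)) (psnd p)) \<and> Q' (pair (psnd (pfst p)) (psnd p))"]) simp_all
qed

lemma sigma_pr_conj: "sigma_pr n P \<Longrightarrow> sigma_pr n Q \<Longrightarrow> sigma_pr n (\<lambda>x. P x \<and> Q x)"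
  and sigma_pr_disj: "sigma_pr n P \<Longrightarrow> sigma_pr n Q \<Longrightarrow> sigma_pr n (\<lambda>x. P x \<or> Q x)"
  using sigma_pr_conj_disj by blast+

text \<open>Every number codes an infinite sequence, read off by iterating \<open>psnd\<close>. No
  length is stored; each finite sequence is an initial part of some coded one.\<close>

definition entry :: "nat \<Rightarrow> nat \<Rightarrow> nat" where
  "entry c i = pfst ((psnd ^^ i) c)"

lemma ex_entry: "\<exists>c. \<forall>i<n. entry c i = g i"
proof (induction n arbitrary: g)
  case (Suc n)
  obtain c where "\<forall>i<n. entry c i = g (Suc i)" using Suc.IH[of "g \<circ> Suc"] by auto
  then have "\<forall>i<Suc n. entry (pair (g 0) c) i = g i"
    by (auto simp: entry_def less_Suc_eq_0_disj funpow_swap1 simp del: funpow.simps(2))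
      (simp_all add: funpow_swap1[symmetric] funpow_Suc_right del: funpow.simps(2))
  then show ?case by blast
qed simp

lemma pr_fun_entry [pr_intros]:
  assumes "pr_fun G a" "pr_fun G b"
  shows "pr_fun G (\<lambda>x. entry (a x) (b x))"
proof -
  have "(psnd ^^ i) c = rec_nat c (\<lambda>_ r. psnd r) i" for c i
    by (induction i) simp_all
  then have eq: "entry c i = pfst (rec_nat c (\<lambda>_ r. psnd r) i)" for c i
    by (simp add: entry_def)
  show ?thesis unfolding eq by (intro pr_intros assms)
qed

text \<open>Collection: one code gathers a witness for each i below the bound. The existential
  quantifier moves to the front, and a bounded existential statement about \<open>Q\<close> remains,
  which is why both bounded quantifiers share the induction.\<close>

lemma sigma_pr_bounded:
  "sigma_pr n (\<lambda>p. P (pfst p) (psnd p)) \<Longrightarrow> pr_fun {} b \<Longrightarrow>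
    sigma_pr n (\<lambda>x. \<forall>i<b x. P i x) \<and> sigma_pr n (\<lambda>x. \<exists>i<b x. P i x)"
proof (induction n arbitrary: P b)
  case 0
  then show ?case by (auto intro: pr_pred_all_less pr_pred_ex_less)
next
  case (Suc n)
  obtain Q where Q: "sigma_pr n Q" "\<And>p. P (pfst p) (psnd p) \<longleftrightarrow> (\<exists>y. \<not> Q (pair y p))"
    using Suc.prems(1) by auto
  have P: "P i x \<longleftrightarrow> (\<exists>y. \<not> Q (pair y (pair i x)))" for i x
    using Q(2)[of "pair i x"] by simp
  have f: "pr_fun {} (\<lambda>p. pair (entry (pfst (psnd p)) (pfst p)) (pair (pfst p) (psnd (psnd p))))"
    by (intro pr_intros)
  have b: "pr_fun {} (\<lambda>p. b (psnd p))" by (intro pr_fun_comp[OF Suc.prems(2)] pr_intros)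
  have "sigma_pr n (\<lambda>p. \<exists>i<b (psnd p). Q (pair (entry (pfst p) i) (pair i (psnd p))))"
    using Suc.IH[OF sigma_pr_subst[OF Q(1) f] b] by blast
  moreover have "(\<forall>i<b x. P i x) \<longleftrightarrow> (\<exists>c. \<not> (\<exists>i<b x. Q (pair (entry c i) (pair i x))))" for x
  proof
    assume "\<forall>i<b x. P i x"
    then have "\<forall>i. \<exists>y. i < b x \<longrightarrow> \<not> Q (pair y (pair i x))" unfolding P by blast
    then obtain g where g: "\<And>i. i < b x \<Longrightarrow> \<not> Q (pair (g i) (pair i x))" by metis
    obtain c where "\<forall>i<b x. entry c i = g i" using ex_entry by blast
    with g show "\<exists>c. \<not> (\<exists>i<b x. Q (pair (entry c i) (pair i x)))"
      by (intro exI[of _ c]) auto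
  qed (auto simp: P)
  ultimately have "sigma_pr (Suc n) (\<lambda>x. \<forall>i<b x. P i x)"
    unfolding sigma_pr.simps
    by (intro exI[of _ "\<lambda>p. \<exists>i<b (psnd p). Q (pair (entry (pfst p) i) (pair i (psnd p)))"]) simp
  moreover have "sigma_pr (Suc n) (\<lambda>x. \<exists>i. i < b x \<and> P i x)"
    by (intro sigma_pr_ex sigma_pr_conj Suc.prems(1) sigma_pr_pr pr_intros b)
  ultimately show ?case by simp
qed

section \<open>Closure properties of the \<Delta> predicates\<close>

lemma delta_pr_sigma_pr: "delta_pr n P \<Longrightarrow> sigma_pr n P"
  by (simp add: delta_pr_def)

named_theorems delta_pr_intros

lemma delta_pr_pr: "pr_pred {} P \<Longrightarrow> delta_pr n P"
  unfolding delta_pr_def by (intro conjI sigma_pr_pr pr_pred_not)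

lemma delta_pr_Suc: "sigma_pr n P \<Longrightarrow> delta_pr (Suc n) P"
  unfolding delta_pr_def by (intro conjI sigma_pr_Suc sigma_pr_Suc_not) simp_all

lemma delta_pr_not [delta_pr_intros]: "delta_pr n P \<Longrightarrow> delta_pr n (\<lambda>x. \<not> P x)"
  unfolding delta_pr_def not_not by (elim conjE, intro conjI)

lemma delta_pr_conj [delta_pr_intros]: "delta_pr n P \<Longrightarrow> delta_pr n Q \<Longrightarrow> delta_pr n (\<lambda>x. P x \<and> Q x)"
  unfolding delta_pr_def de_Morgan_conj by (elim conjE, intro conjI sigma_pr_conj sigma_pr_disj)

lemma delta_pr_disj [delta_pr_intros]: "delta_pr n P \<Longrightarrow> delta_pr n Q \<Longrightarrow> delta_pr n (\<lambda>x. P x \<or> Q x)"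
  unfolding delta_pr_def de_Morgan_disj by (elim conjE, intro conjI sigma_pr_conj sigma_pr_disj)

lemma delta_pr_imp [delta_pr_intros]: "delta_pr n P \<Longrightarrow> delta_pr n Q \<Longrightarrow> delta_pr n (\<lambda>x. P x \<longrightarrow> Q x)"
  unfolding imp_conv_disj by (intro delta_pr_disj delta_pr_not)

lemma delta_pr_all_less [delta_pr_intros]:
  assumes "delta_pr n (\<lambda>p. P (pfst p) (psnd p))" "pr_fun {} b"
  shows "delta_pr n (\<lambda>x. \<forall>i<b x. P i x)"
proof -
  have "(\<not> (\<forall>i<b x. P i x)) \<longleftrightarrow> (\<exists>i<b x. \<not> P i x)" for x by blast
  with assms sigma_pr_bounded[of n P b] sigma_pr_bounded[of n "\<lambda>i x. \<not> P i x" b] show ?thesis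
    unfolding delta_pr_def by simp
qed

section \<open>Passage to the hierarchy of list relations\<close>

lemma recursive_if_prim_rec_in: "prim_rec_in {} h \<Longrightarrow> recursive h"
proof (induction rule: prim_rec_in.induct)
  case (comp h fs)
  then show ?case by (intro recursive.comp) auto
next
  case (prec b s)
  then show ?case by (intro recursive.prec)
qed (simp_all add: recursive.intros(1-3))

lemma sigma_cong: "sigma n k P \<Longrightarrow> (\<And>xs. length xs = k \<Longrightarrow> P xs \<longleftrightarrow> P' xs) \<Longrightarrow> sigma n k P'"
  by (cases n) auto

lemma sigma_if_sigma_pr: "sigma_pr n P \<Longrightarrow> prim_rec_in {} h \<Longrightarrow> sigma n k (\<lambda>xs. P (h xs))"
proof (induction n arbitrary: P k h)
  case 0
  then have "prim_rec_in {} (\<lambda>xs. of_bool (P (h xs)))"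
    using prim_rec_in_comp1[of "{}" "\<lambda>x. of_bool (P x)" h] by (simp add: pr_pred_def pr_fun_def)
  then show ?case by (auto dest: recursive_if_prim_rec_in)
next
  case (Suc n)
  then obtain Q where Q: "sigma_pr n Q" "\<And>x. P x \<longleftrightarrow> (\<exists>y. \<not> Q (pair y x))" by auto
  \<comment> \<open>The new variable is the head. The tail is rebuilt from k projections, because
    \<open>comp_list\<close> passes on a fixed number of arguments; on lists of length Suc k this
    loses nothing.\<close>
  define h' where "h' xs = pair (proj 0 xs) (h (map (\<lambda>i. proj (Suc i) xs) [0..<k]))" for xs
  have "prim_rec_in {} (comp_list h (map (\<lambda>i. proj (Suc i)) [0..<k]))"
    using Suc.prems(2) by (intro prim_rec_in.comp) (auto intro: prim_rec_in.proj)
  then have "prim_rec_in {} h'"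
    unfolding h'_def by (intro prim_rec_in_pair prim_rec_in.proj) (simp add: comp_list_eq comp_def)
  from Suc.IH[OF Q(1) this, of "Suc k"] have "sigma n (Suc k) (\<lambda>xs. Q (h' xs))" .
  moreover have "P (h xs) \<longleftrightarrow> (\<exists>y. \<not> Q (h' (y # xs)))" if "length xs = k" for xs
  proof -
    have "map (\<lambda>i. proj (Suc i) (y # xs)) [0..<k] = xs" for y
      using that by (intro nth_equalityI) (auto simp: proj_def)
    then have "h' (y # xs) = pair y (h xs)" for y by (simp only: h'_def proj_Cons(1))
    then show ?thesis by (simp add: Q(2))
  qed
  ultimately show ?case unfolding sigma.simps by blast
qed

lemma delta_fun_if_sigma_pr:
  assumes "sigma_pr (Suc n) (\<lambda>z. f (pfst z) = psnd z)"
  shows "delta_fun (Suc n) f"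
proof -
  have h: "prim_rec_in {} (\<lambda>xs. pair (proj 0 xs) (proj 1 xs))"
    by (intro prim_rec_in_pair prim_rec_in.proj)
  \<comment> \<open>For a total function the complement of the graph is existential over the graph,
    so one half of \<Delta> yields the other.\<close>
  have neq: "f x \<noteq> y \<longleftrightarrow> (\<exists>w. w \<noteq> y \<and> f x = w)" for x y by blast
  have "pr_fun {} (\<lambda>p. pair (pfst (psnd p)) (pfst p))" by (intro pr_intros)
  from sigma_pr_subst[OF assms this] have "sigma_pr (Suc n) (\<lambda>p. f (pfst (psnd p)) = pfst p)" by simp
  moreover have "sigma_pr (Suc n) (\<lambda>p. pfst p \<noteq> psnd (psnd p))" by (intro sigma_pr_pr pr_intros)
  ultimately have ne: "sigma_pr (Suc n) (\<lambda>z. f (pfst z) \<noteq> psnd z)"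
    unfolding neq by (intro sigma_pr_ex sigma_pr_conj)
  from sigma_if_sigma_pr[OF assms h, of 2] have "sigma (Suc n) 2 (\<lambda>xs. f (xs ! 0) = xs ! 1)"
    by (rule sigma_cong) (simp add: proj_def)
  moreover from sigma_if_sigma_pr[OF ne h, of 2] have "sigma (Suc n) 2 (\<lambda>xs. f (xs ! 0) \<noteq> xs ! 1)"
    by (rule sigma_cong) (simp add: proj_def)
  ultimately show ?thesis by (simp only: delta_fun_def delta_def pi_rel_def)
qed

lemma sigma_pr_ex_all:
  assumes "pr_pred {} (\<lambda>q. R (pfst q) (pfst (psnd q)) (psnd (psnd q)))"
  shows "sigma_pr 2 (\<lambda>x. \<exists>b. \<forall>z. R z b x)"
proof -
  have "sigma_pr 1 (\<lambda>p. \<exists>z. \<not> R z (pfst p) (psnd p))"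
    unfolding One_nat_def by (intro sigma_pr_ex sigma_pr_pr pr_intros assms)
  then show ?thesis
    unfolding numeral_2_eq_2 sigma_pr.simps(2)[of "Suc 0"] One_nat_def
    by (intro exI[of _ "\<lambda>p. \<exists>z. \<not> R z (pfst p) (psnd p)"]) simp
qed


section \<open>Isomorphisms are $\Delta^0_3$\<close>

lemma delta_pr_omega_part:
  assumes "punctual A" "pr_fun {} a"
  shows "delta_pr 3 (\<lambda>x. a x \<in> omega_part A)"
proof -
  \<comment> \<open>For sets of numbers, finite means bounded; this gives the \<exists>\<forall>
    form.\<close>
  have eq: "x \<in> omega_part A \<longleftrightarrow> (\<exists>b. \<forall>y. A y x \<longrightarrow> y \<le> b)" for x
    by (auto simp: omega_part_def finite_nat_set_iff_bounded_le)
  have "sigma_pr 2 (\<lambda>x. a x \<in> omega_part A)"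
    unfolding eq by (intro sigma_pr_ex_all pr_intros pr_pred_punctual[OF assms(1)] pr_fun_comp[OF assms(2)])
  from delta_pr_Suc[OF this] show ?thesis by (simp add: eval_nat_numeral)
qed

text \<open>One bound \<open>b\<close> for both sets turns their cardinalities into bounded sums.
  Apart from the choice of \<open>b\<close>, everything is then universal over a primitive recursive
  matrix if both orders are punctual.\<close>

lemma same_position_iff:
  "same_position A B x y \<longleftrightarrow> (\<exists>b. \<forall>z. (A z x \<longrightarrow> z < b) \<and> (B z y \<longrightarrow> z < b) \<and>
     (\<Sum>i<b. of_bool (A i x)) = (\<Sum>i<b. of_bool (B i y) :: nat))" (is "_ \<longleftrightarrow> ?R")
proof -
  have sum: "(\<Sum>i<b. of_bool (C i x)) = card {z. C z x}" if "\<And>z. C z x \<Longrightarrow> z < b"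
    for C :: "nat \<Rightarrow> nat \<Rightarrow> bool" and b x
  proof -
    have "{..<b} \<inter> {z. C z x} = {z. C z x}" using that by auto
    then show ?thesis by (simp add: sum_of_bool_eq)
  qed
  show ?thesis
  proof
    assume L: "same_position A B x y"
    then obtain b c where "\<And>z. A z x \<Longrightarrow> z < b" "\<And>z. B z y \<Longrightarrow> z < c"
      by (auto simp: same_position_def omega_part_def finite_nat_set_iff_bounded)
    then have "\<And>z. A z x \<Longrightarrow> z < max b c" "\<And>z. B z y \<Longrightarrow> z < max b c"
      by (auto simp: less_max_iff_disj)
    with L sum[of A x "max b c"] sum[of B y "max b c"] show ?R
      by (intro exI[of _ "max b c"]) (simp add: same_position_def)
  next
    assume ?R
    then obtain b where b: "\<And>z. A z x \<Longrightarrow> z < b" "\<And>z. B z y \<Longrightarrow> z < b"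
      "(\<Sum>i<b. of_bool (A i x)) = (\<Sum>i<b. of_bool (B i y) :: nat)" by blast
    then show "same_position A B x y"
      using sum[of A x b] sum[of B y b]
      by (auto simp: same_position_def omega_part_def finite_nat_set_iff_bounded)
  qed
qed

lemma delta_pr_same_position:
  assumes "punctual A" "punctual B" "pr_fun {} a" "pr_fun {} b"
  shows "delta_pr 3 (\<lambda>x. same_position A B (a x) (b x))"
proof -
  have "sigma_pr 2 (\<lambda>x. same_position A B (a x) (b x))"
    unfolding same_position_iff
    by (intro sigma_pr_ex_all pr_intros pr_pred_punctual[OF assms(1)] pr_pred_punctual[OF assms(2)] pr_fun_comp[OF assms(3)] pr_fun_comp[OF assms(4)])
  from delta_pr_Suc[OF this] show ?thesis by (simp add: eval_nat_numeral)
qed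

lemma delta_pr_fits:
  assumes "punctual A" "punctual B" "pr_fun {} c" "pr_fun {} a" "pr_fun {} b"
  shows "delta_pr 3 (\<lambda>x. fits A B (entry (c x)) (a x) (b x))"
  unfolding fits_def iff_conv_conj_imp
  by (intro delta_pr_intros delta_pr_omega_part delta_pr_same_position assms delta_pr_pr pr_intros pr_pred_punctual[OF assms(1)] pr_pred_punctual[OF assms(2)]
      pr_fun_comp[OF assms(3)] pr_fun_comp[OF assms(4)] pr_fun_comp[OF assms(5)])

lemma fits_cong: "(\<And>i. i < x \<Longrightarrow> f i = g i) \<Longrightarrow> fits A B f x y \<longleftrightarrow> fits A B g x y"
  by (simp add: fits_def)

context omega_eta_pair
begin

text \<open>The course of values up to x is guessed as one code, and each entry is checked to be the
  least fitting value relative to the entries before it. The check uses only bounded quantifiers, so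
  \<Delta>-3 conditions stay \<Delta>-3 and the guess makes the graph \<Sigma>-3.\<close>

lemma forth_graph:
  "forth A B x = y \<longleftrightarrow> (\<exists>c. entry c x = y \<and> (\<forall>i<Suc x. fits A B (entry c) i (entry c i) \<and>
     (\<forall>z<entry c i. \<not> fits A B (entry c) i z)))"
proof
  assume y: "forth A B x = y"
  obtain c where c: "\<And>i. i < Suc x \<Longrightarrow> entry c i = forth A B i" using ex_entry by blast
  have *: "fits A B (entry c) i z \<longleftrightarrow> fits A B (forth A B) i z" if "i < Suc x" for i z
    using that by (intro fits_cong c) simp
  have "\<not> fits A B (forth A B) i z" if "z < forth A B i" for i z
    using that unfolding forth_eq[of A B i] by (rule not_less_Least)
  then show "\<exists>c. entry c x = y \<and> (\<forall>i<Suc x. fits A B (entry c) i (entry c i) \<and>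
     (\<forall>z<entry c i. \<not> fits A B (entry c) i z))"
    using y c fits_forth by (intro exI[of _ c]) (simp add: *)
next
  assume "\<exists>c. entry c x = y \<and> (\<forall>i<Suc x. fits A B (entry c) i (entry c i) \<and>
     (\<forall>z<entry c i. \<not> fits A B (entry c) i z))"
  then obtain c where c: "entry c x = y"
    "\<And>i. i < Suc x \<Longrightarrow> fits A B (entry c) i (entry c i)"
    "\<And>i z. i < Suc x \<Longrightarrow> z < entry c i \<Longrightarrow> \<not> fits A B (entry c) i z" by blast
  have "forth A B i = entry c i" if "i < Suc x" for i
    using that
  proof (induction i rule: less_induct)
    case (less i)
    have "fits A B (forth A B) i z \<longleftrightarrow> fits A B (entry c) i z" for z
      using less by (intro fits_cong) simp
    then show ?case
      unfolding forth_eq[of A B i] using c(2,3)[OF less.prems]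
      by (intro Least_equality) (auto simp: not_less[symmetric])
  qed
  with c(1) show "forth A B x = y" by simp
qed

lemma sigma_pr_forth:
  assumes "punctual A" "punctual B" "pr_fun {} a" "pr_fun {} b"
  shows "sigma_pr 3 (\<lambda>z. forth A B (a z) = b z)"
proof -
  note pr = pr_intros pr_fun_comp[OF assms(3)] pr_fun_comp[OF assms(4)]
  have "delta_pr 3 (\<lambda>p. entry (pfst p) (a (psnd p)) = b (psnd p))"
    by (intro delta_pr_pr pr)
  moreover have "delta_pr 3 (\<lambda>p. \<forall>i<Suc (a (psnd p)). fits A B (entry (pfst p)) i (entry (pfst p) i) \<and>
      (\<forall>z<entry (pfst p) i. \<not> fits A B (entry (pfst p)) i z))"
    by (intro delta_pr_intros delta_pr_fits assms(1,2) pr)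
  ultimately show ?thesis
    unfolding forth_graph numeral_3_eq_3 by (intro sigma_pr_ex delta_pr_sigma_pr delta_pr_conj)
qed

lemma delta_fun_forth:
  assumes "punctual A" "punctual B"
  shows "delta_fun 3 (forth A B)" "delta_fun 3 (inv (forth A B))"
proof -
  have "sigma_pr 3 (\<lambda>z. forth A B (pfst z) = psnd z)"
    by (intro sigma_pr_forth assms pr_intros)
  then show "delta_fun 3 (forth A B)"
    unfolding numeral_3_eq_3 by (rule delta_fun_if_sigma_pr)
  \<comment> \<open>The graph of the inverse is the same graph with its coordinates
    exchanged.\<close>
  have "inv (forth A B) x = y \<longleftrightarrow> forth A B y = x" for x y
    by (metis inj_forth surj_forth inv_f_f)
  moreover have "sigma_pr 3 (\<lambda>z. forth A B (psnd z) = pfst z)"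
    by (intro sigma_pr_forth assms pr_intros)
  ultimately have "sigma_pr 3 (\<lambda>z. inv (forth A B) (pfst z) = psnd z)" by simp
  then show "delta_fun 3 (inv (forth A B))"
    unfolding numeral_3_eq_3 by (rule delta_fun_if_sigma_pr)
qed

end

lemma Cone_Delta_subset_PrCat:
  assumes "punctual A" "A \<cong> omega_plus_eta"
  shows "Cone_Delta 3 \<subseteq> PrCat A"
proof
  fix d assume d: "d \<in> Cone_Delta 3"
  have "\<exists>f. isomorphism A B f \<and> pr_le_degree f d \<and> pr_le_degree (inv f) d"
    if "punctual B" "A \<cong> B" for B
  proof -
    note B = that
    obtain g h where "isomorphism A B g" "isomorphism A omega_plus_eta h"
      using B(2) assms(2) by (auto simp: isomorphic_def)
    then have "B \<cong> omega_plus_eta"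
      using isomorphism_comp isomorphism_inv unfolding isomorphic_def by blast
    with assms(2) interpret omega_eta_pair A B
      by (simp add: isomorphic_omega_plus_eta_iff omega_eta_pair.intro)
    show ?thesis
      using isomorphism_forth delta_fun_forth[OF assms(1) B(1)] d by (auto simp: Cone_Delta_def)
  qed
  with d show "d \<in> PrCat A" by (auto simp: PrCat_def Cone_Delta_def)
qed


section \<open>Recursive matrices\<close>

declare sigma_pr.simps [simp del]

text \<open>Here m is a fixed number and the predicates need not be uniform in i, as with the
  finitely many inner functions of a composition.\<close>

lemma sigma_pr_finite_all: "(\<And>i. i < m \<Longrightarrow> sigma_pr n (P i)) \<Longrightarrow> sigma_pr n (\<lambda>x. \<forall>i<m::nat. P i x)"
proof (induction m)
  case 0
  have "sigma_pr n (\<lambda>x. True)" by (intro sigma_pr_pr pr_intros)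
  then show ?case by simp
next
  case (Suc m)
  have eq: "(\<forall>i<Suc m. P i x) \<longleftrightarrow> (\<forall>i<m. P i x) \<and> P m x" for x by (auto simp: less_Suc_eq)
  show ?case unfolding eq by (rule sigma_pr_conj[OF Suc.IH]) (simp_all add: Suc.prems)
qed

lemma pr_fun_proj_map: "\<forall>a\<in>set as. pr_fun G a \<Longrightarrow> pr_fun G (\<lambda>z. proj i (map (\<lambda>a. a z) as))"
  by (cases "i < length as") (simp_all add: proj_def pr_fun_const)

lemma pr_fun_map_comp:
  assumes "\<forall>a\<in>set as. pr_fun G a" "pr_fun G g"
  shows "\<forall>a\<in>set (map (\<lambda>a p. a (g p)) as). pr_fun G a"
proof
  fix c assume "c \<in> set (map (\<lambda>a p. a (g p)) as)"
  then obtain a where "a \<in> set as" "c = (\<lambda>p. a (g p))" by auto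
  with assms pr_fun_comp show "pr_fun G c" by blast
qed

text \<open>Arities change along the induction, so the arguments are a list of unary primitive
  recursive functions of one code. A composition guesses its intermediate values as one code, a
  recursion its whole history; the induction hypotheses are applied to projections of the
  guess.\<close>

lemma sigma_pr_graph_recursive:
  "recursive f \<Longrightarrow> \<forall>a\<in>set as. pr_fun {} a \<Longrightarrow> pr_fun {} b \<Longrightarrow>
    sigma_pr (Suc 0) (\<lambda>z. f (map (\<lambda>a. a z) as) = b z)"
proof (induction arbitrary: as b rule: recursive.induct)
  case zero
  then show ?case by (intro sigma_pr_pr pr_intros)
next
  case suc
  then show ?case by (intro sigma_pr_pr pr_intros pr_fun_proj_map)
next
  case (proj i)
  then show ?case by (intro sigma_pr_pr pr_pred_eq pr_fun_proj_map)
next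
  case (comp h fs)
  let ?as = "map (\<lambda>a p. a (psnd p)) as" and ?es = "map (\<lambda>i p. entry (pfst p) i) [0..<length fs]"
  have as: "\<forall>a\<in>set ?as. pr_fun {} a"
    by (intro pr_fun_map_comp comp.prems(1) pr_intros)
  have es: "\<forall>a\<in>set ?es. pr_fun {} a"
    using pr_fun_entry[OF pr_fun_pfst[OF pr_fun_id] pr_fun_const] by simp
  have b: "pr_fun {} (\<lambda>p. b (psnd p))" by (intro pr_fun_comp[OF comp.prems(2)] pr_intros)
  have "sigma_pr (Suc 0) (\<lambda>p. (fs ! i) (map (\<lambda>a. a p) ?as) = entry (pfst p) i)" if "i < length fs" for i
    by (rule comp.IH(2)[OF nth_mem[OF that] as]) (intro pr_intros)
  then have "sigma_pr (Suc 0) (\<lambda>p. \<forall>i<length fs. (fs ! i) (map (\<lambda>a. a p) ?as) = entry (pfst p) i)"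
    by (rule sigma_pr_finite_all)
  from sigma_pr_conj[OF this comp.IH(1)[OF es b]]
  have sigma_pr: "sigma_pr (Suc 0) (\<lambda>p. (\<forall>i<length fs. (fs ! i) (map (\<lambda>a. a (psnd p)) as) = entry (pfst p) i) \<and>
      h (map (entry (pfst p)) [0..<length fs]) = b (psnd p))"
    by (simp add: comp_def)
  have "comp_list h fs xs = y \<longleftrightarrow>
      (\<exists>c. (\<forall>i<length fs. (fs ! i) xs = entry c i) \<and> h (map (entry c) [0..<length fs]) = y)" for xs y
  proof -
    have eq: "map (\<lambda>f. f xs) fs = map (entry c) [0..<length fs]"
      if "\<forall>i<length fs. (fs ! i) xs = entry c i" for c
      using that by (intro nth_equalityI) auto
    obtain c where "\<forall>i<length fs. entry c i = (fs ! i) xs"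
      using ex_entry[of "length fs" "\<lambda>i. (fs ! i) xs"] by blast
    then have c: "\<forall>i<length fs. (fs ! i) xs = entry c i" by simp
    show ?thesis
    proof
      assume "comp_list h fs xs = y"
      then have "h (map (entry c) [0..<length fs]) = y" unfolding comp_list_def eq[OF c] .
      with c show "\<exists>c. (\<forall>i<length fs. (fs ! i) xs = entry c i) \<and> h (map (entry c) [0..<length fs]) = y"
        by blast
    next
      assume "\<exists>c. (\<forall>i<length fs. (fs ! i) xs = entry c i) \<and> h (map (entry c) [0..<length fs]) = y"
      then obtain c' where c': "\<forall>i<length fs. (fs ! i) xs = entry c' i"
        and "h (map (entry c') [0..<length fs]) = y" by blast
      then show "comp_list h fs xs = y" unfolding comp_list_def eq[OF c'] by blast
    qed
  qed
  then show ?case using sigma_pr_ex[OF sigma_pr] by simp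
next
  case (prec b0 s)
  show ?case
  proof (cases as)
    case Nil
    \<comment> \<open>On the empty list \<open>prec\<close> has the default value 0.\<close>
    have "sigma_pr (Suc 0) (\<lambda>z. 0 = b z)" by (intro sigma_pr_pr pr_intros prec.prems(2))
    then show ?thesis by (simp add: Nil prec_def)
  next
    case (Cons n ps)
    have n: "pr_fun {} n" and ps: "\<forall>a\<in>set ps. pr_fun {} a" using prec.prems(1) Cons by auto
    let ?ps = "map (\<lambda>a p. a (psnd p)) ps"
    let ?s = "(\<lambda>p. entry (pfst (psnd p)) (pfst p)) # (\<lambda>p. pfst p) # map (\<lambda>a p. a (psnd (psnd p))) ps"
    have 1: "\<forall>a\<in>set ?ps. pr_fun {} a"
      by (intro pr_fun_map_comp ps pr_intros)
    have 2: "\<forall>a\<in>set ?s. pr_fun {} a"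
      unfolding list.set ball_simps by (intro conjI pr_fun_map_comp ps pr_intros)
    have nc: "pr_fun {} (\<lambda>p. n (psnd p))" by (intro pr_fun_comp[OF n] pr_intros)
    have e0: "pr_fun {} (\<lambda>p. entry (pfst p) 0)"
      and eS: "pr_fun {} (\<lambda>p. entry (pfst (psnd p)) (Suc (pfst p)))" by (intro pr_intros)+
    have "sigma_pr (Suc 0) (\<lambda>p. entry (pfst p) (n (psnd p)) = b (psnd p))"
      by (intro sigma_pr_pr pr_intros pr_fun_comp[OF prec.prems(2)] pr_fun_comp[OF n])
    moreover have "sigma_pr (Suc 0) (\<lambda>p. s (map (\<lambda>a. a p) ?s) = entry (pfst (psnd p)) (Suc (pfst p)))"
      by (rule prec.IH(2)[OF 2 eS])
    then have "sigma_pr (Suc 0) (\<lambda>p. s (entry (pfst (psnd p)) (pfst p) # pfst p # map (\<lambda>a. a (psnd (psnd p))) ps) =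
        entry (pfst (psnd p)) (Suc (pfst p)))" by (simp add: comp_def)
    from sigma_pr_bounded[of "Suc 0" "\<lambda>i q. s (entry (pfst q) i # i # map (\<lambda>a. a (psnd q)) ps) = entry (pfst q) (Suc i)",
        OF this nc]
    have "sigma_pr (Suc 0) (\<lambda>p. \<forall>i<n (psnd p). s (entry (pfst p) i # i # map (\<lambda>a. a (psnd p)) ps) =
        entry (pfst p) (Suc i))" by blast
    moreover have "sigma_pr (Suc 0) (\<lambda>p. b0 (map (\<lambda>a. a (psnd p)) ps) = entry (pfst p) 0)"
      using prec.IH(1)[OF 1 e0] by (simp add: comp_def)
    ultimately have sigma_pr: "sigma_pr (Suc 0) (\<lambda>p. (b0 (map (\<lambda>a. a (psnd p)) ps) = entry (pfst p) 0 \<and>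
        (\<forall>i<n (psnd p). s (entry (pfst p) i # i # map (\<lambda>a. a (psnd p)) ps) = entry (pfst p) (Suc i))) \<and>
        entry (pfst p) (n (psnd p)) = b (psnd p))"
      by (intro sigma_pr_conj)
    have "prec b0 s (k # xs) = y \<longleftrightarrow> (\<exists>c. (b0 xs = entry c 0 \<and>
        (\<forall>i<k. s (entry c i # i # xs) = entry c (Suc i))) \<and> entry c k = y)" for k xs y
    proof -
      define r where "r = rec_nat (b0 xs) (\<lambda>m r. s (r # m # xs))"
      obtain c where c: "\<forall>i<Suc k. entry c i = r i" using ex_entry[of "Suc k" r] by blast
      have "entry c' k = r k"
        if "b0 xs = entry c' 0" "\<forall>i<k. s (entry c' i # i # xs) = entry c' (Suc i)" for c'
      proof -
        have "i \<le> k \<Longrightarrow> entry c' i = r i" for i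
        proof (induction i)
          case (Suc i)
          have "entry c' (Suc i) = s (entry c' i # i # xs)" using that(2) Suc.prems by simp
          moreover have "entry c' i = r i" using Suc by simp
          ultimately show ?case by (simp only: r_def nat.rec)
        qed (simp add: r_def that(1))
        then show ?thesis by simp
      qed
      moreover have "b0 xs = entry c 0" "\<forall>i<k. s (entry c i # i # xs) = entry c (Suc i)" "entry c k = r k"
        using c by (simp_all add: r_def)
      moreover have "prec b0 s (k # xs) = r k" by (simp add: prec_def r_def)
      ultimately show ?thesis by metis
    qed
    then show ?thesis using sigma_pr_ex[OF sigma_pr] by (simp add: Cons)
  qed
next
  case (mu f)
  let ?b = "b # as" and ?i = "(\<lambda>p. pfst (psnd p)) # map (\<lambda>a p. a (psnd (psnd p))) as"
  have "\<forall>a\<in>set ?b. pr_fun {} a" using mu.prems by simp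
  from mu.IH[OF this pr_fun_const, of 0] have b: "sigma_pr (Suc 0) (\<lambda>z. f (b z # map (\<lambda>a. a z) as) = 0)"
    by simp
  have "\<forall>a\<in>set ?i. pr_fun {} a"
    unfolding list.set ball_simps by (intro conjI pr_fun_map_comp mu.prems(1) pr_intros)
  from mu.IH[OF this pr_fun_pfst[OF pr_fun_id]]
  have "sigma_pr (Suc 0) (\<lambda>p. f (pfst (psnd p) # map (\<lambda>a. a (psnd (psnd p))) as) = pfst p)"
    by (simp add: comp_def)
  moreover have "sigma_pr (Suc 0) (\<lambda>p. 0 < pfst p)" by (intro sigma_pr_pr pr_intros)
  ultimately have "sigma_pr (Suc 0) (\<lambda>p. 0 < pfst p \<and> f (pfst (psnd p) # map (\<lambda>a. a (psnd (psnd p))) as) = pfst p)"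
    by (intro sigma_pr_conj)
  from sigma_pr_ex[OF this] have "sigma_pr (Suc 0) (\<lambda>q. \<exists>v. 0 < v \<and> f (pfst q # map (\<lambda>a. a (psnd q)) as) = v)" .
  from sigma_pr_bounded[of "Suc 0" "\<lambda>i z. \<exists>v. 0 < v \<and> f (i # map (\<lambda>a. a z) as) = v", OF this mu.prems(2)] b
  have sigma_pr: "sigma_pr (Suc 0) (\<lambda>z. f (b z # map (\<lambda>a. a z) as) = 0 \<and>
      (\<forall>i<b z. \<exists>v. 0 < v \<and> f (i # map (\<lambda>a. a z) as) = v))" by (intro sigma_pr_conj) blast+
  \<comment> \<open>Below the minimum the value is asserted to be some positive v: the graph of
    \<open>f\<close> is known to be existential, its complement is not.\<close>
  have "(LEAST y. f (y # xs) = 0) = k \<longleftrightarrow> f (k # xs) = 0 \<and> (\<forall>i<k. \<exists>v. 0 < v \<and> f (i # xs) = v)" for xs k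
  proof
    assume "(LEAST y. f (y # xs) = 0) = k"
    with LeastI_ex[OF mu.hyps(2)[of xs]] not_less_Least[of _ "\<lambda>y. f (y # xs) = 0"]
    show "f (k # xs) = 0 \<and> (\<forall>i<k. \<exists>v. 0 < v \<and> f (i # xs) = v)" by blast
  next
    assume k: "f (k # xs) = 0 \<and> (\<forall>i<k. \<exists>v. 0 < v \<and> f (i # xs) = v)"
    then show "(LEAST y. f (y # xs) = 0) = k"
      by (intro Least_equality) (auto simp: not_less[symmetric])
  qed
  with sigma_pr show ?case by simp
qed

text \<open>The induction starts at level 1, where the quantifier hidden in the graph of the
  recursive matrix is absorbed by the existential quantifier in front of it.\<close>

lemma sigma_pr_if_sigma:
  "sigma (Suc n) k P \<Longrightarrow> length as = k \<Longrightarrow> \<forall>a\<in>set as. pr_fun {} a \<Longrightarrow>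
    sigma_pr (Suc n) (\<lambda>z. P (map (\<lambda>a. a z) as))"
proof (induction n arbitrary: k P as)
  have as': "\<forall>a\<in>set (pfst # map (\<lambda>a p. a (psnd p)) as). pr_fun {} a" if "\<forall>a\<in>set as. pr_fun {} a" for as
    unfolding list.set ball_simps
    by (intro conjI pr_fun_map_comp that pr_fun_psnd pr_fun_id pr_fun_pfst[OF pr_fun_id])
  {
    case 0
    then obtain Q h where Q: "\<And>xs. length xs = k \<Longrightarrow> P xs \<longleftrightarrow> (\<exists>y. \<not> Q (y # xs))"
      and h: "recursive h" "\<And>xs. length xs = Suc k \<Longrightarrow> h xs = of_bool (Q xs)" by auto
    from sigma_pr_graph_recursive[OF h(1) as'[OF 0(3)] pr_fun_const, of 0]
    have "sigma_pr (Suc 0) (\<lambda>p. h (pfst p # map (\<lambda>a. a (psnd p)) as) = 0)" by (simp add: comp_def)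
    from sigma_pr_ex[OF this] have "sigma_pr (Suc 0) (\<lambda>z. \<exists>y. h (y # map (\<lambda>a. a z) as) = 0)" .
    moreover have "P (map (\<lambda>a. a z) as) \<longleftrightarrow> (\<exists>y. h (y # map (\<lambda>a. a z) as) = 0)" for z
      using Q[of "map (\<lambda>a. a z) as"] h(2) 0(2) by simp
    ultimately show ?case by simp
  next
    case (Suc n)
    then obtain Q where Q: "\<And>xs. length xs = k \<Longrightarrow> P xs \<longleftrightarrow> (\<exists>y. \<not> Q (y # xs))"
      and "sigma (Suc n) (Suc k) Q" by (auto simp del: sigma.simps simp: sigma.simps(2)[of "Suc n"])
    from Suc.IH[OF this(2) _ as'[OF Suc.prems(3)]] Suc.prems(2)
    have "sigma_pr (Suc n) (\<lambda>p. Q (pfst p # map (\<lambda>a. a (psnd p)) as))" by (simp add: comp_def)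
    moreover have "P (map (\<lambda>a. a z) as) \<longleftrightarrow> (\<exists>y. \<not> Q (y # map (\<lambda>a. a z) as))" for z
      using Q[of "map (\<lambda>a. a z) as"] Suc.prems(2) by simp
    ultimately show ?case
      unfolding sigma_pr.simps(2)[of "Suc n"]
      by (intro exI[of _ "\<lambda>p. Q (pfst p # map (\<lambda>a. a (psnd p)) as)"]) simp
  }
qed

lemma delta_fun_3_matrix:
  assumes "delta_fun 3 f"
  obtains Q where "pr_pred {} Q"
    "\<And>n y. f n = y \<longleftrightarrow> (\<exists>a. \<forall>b. \<exists>c. Q (pair c (pair b (pair a (pair n y)))))"
proof -
  have "sigma (Suc 2) 2 (\<lambda>xs. f (xs ! 0) = xs ! 1)"
    using assms by (simp only: delta_fun_def delta_def numeral_3_eq_3 numeral_2_eq_2)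
  from sigma_pr_if_sigma[OF this, of "[pfst, psnd]"]
  have "sigma_pr (Suc (Suc (Suc 0))) (\<lambda>z. f (pfst z) = psnd z)"
    using pr_fun_pfst[OF pr_fun_id] pr_fun_psnd[OF pr_fun_id]
    by (simp add: numeral_2_eq_2)
  then obtain Q2 Q1 Q0 where "pr_pred {} Q0" "\<And>x. f (pfst x) = psnd x \<longleftrightarrow> (\<exists>y. \<not> Q2 (pair y x))"
    "\<And>x. Q2 x \<longleftrightarrow> (\<exists>y. \<not> Q1 (pair y x))" "\<And>x. Q1 x \<longleftrightarrow> (\<exists>y. \<not> Q0 (pair y x))"
    by (auto simp only: sigma_pr.simps)
  \<comment> \<open>Pushing the negations of the three levels inwards makes the quantifiers
    alternate; the innermost negation stays with the matrix.\<close>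
  then have "pr_pred {} (\<lambda>x. \<not> Q0 x)"
    "\<And>n y. f n = y \<longleftrightarrow> (\<exists>a. \<forall>b. \<exists>c. \<not> Q0 (pair c (pair b (pair a (pair n y)))))"
    using pfst_pair psnd_pair by (auto intro: pr_pred_not) (metis pfst_pair psnd_pair)+
  then show thesis by (rule that)
qed


section \<open>The in-order of the infinite binary tree\<close>

text \<open>The nodes of the tree are the positive numbers; the children of \<open>u\<close> are \<open>2 * u\<close> on the left and
  \<open>2 * u + 1\<close> on the right. The in-order compares the dyadic rationals \<^term>\<open>dyadic u\<close>; the number 0 is
  not a node and becomes a least element.\<close>

definition dyadic :: "nat \<Rightarrow> real" where
  "dyadic x = (2 * x + 1) / 2 ^ floor_log x"

text \<open>Denominators are cleared to keep the comparison within the natural numbers, where it is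
  visibly primitive recursive.\<close>

definition inorder :: "nat \<Rightarrow> nat \<Rightarrow> bool" where
  "inorder x y \<longleftrightarrow> (2 * x + 1) * 2 ^ floor_log y \<le> (2 * y + 1) * 2 ^ floor_log x"

text \<open>Halving climbs to the parent. Since repeated halving ends in 0, \<open>subtree 0\<close>
  contains every number; this is behind the many positivity assumptions.\<close>

definition subtree :: "nat \<Rightarrow> nat set" where
  "subtree u = {y. \<exists>i. y div 2 ^ i = u}"

lemma inorder_iff: "inorder x y \<longleftrightarrow> dyadic x \<le> dyadic y"
proof -
  have "inorder x y \<longleftrightarrow> real ((2 * x + 1) * 2 ^ floor_log y) \<le> real ((2 * y + 1) * 2 ^ floor_log x)"
    unfolding inorder_def by (rule of_nat_le_iff[symmetric])
  then show ?thesis by (simp add: dyadic_def field_simps)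
qed

lemma inorder_refl: "inorder x x"
  by (simp add: inorder_def)

lemma odd_times_power2_inj:
  assumes "odd a" "odd b" "a * 2 ^ i = b * 2 ^ j"
  shows "(a::nat) = b"
  using assms(3)
proof (induction i arbitrary: j)
  case 0
  with assms(1) show ?case by (cases j) auto
next
  case (Suc i)
  with assms(2) show ?case by (cases j) auto
qed

lemma dyadic_eq_iff [simp]: "dyadic x = dyadic y \<longleftrightarrow> x = y"
proof
  assume "dyadic x = dyadic y"
  then have "inorder x y" "inorder y x" by (simp_all add: inorder_iff)
  then have "(2 * x + 1) * 2 ^ floor_log y = (2 * y + 1) * 2 ^ floor_log x"
    unfolding inorder_def by (rule antisym)
  then have "2 * x + 1 = 2 * y + 1"
    by (rule odd_times_power2_inj[rotated 2]) simp_all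
  then show "x = y" by simp
qed simp

lemma floor_log_mult_power2: "x > 0 \<Longrightarrow> r < 2 ^ i \<Longrightarrow> floor_log (x * 2 ^ i + r) = floor_log x + i"
proof (rule floor_log_eqI)
  assume x: "x > 0" "r < 2 ^ i"
  from floor_log_exp2_le[OF x(1)] have "2 ^ floor_log x * 2 ^ i \<le> x * 2 ^ i" by simp
  then show "2 ^ (floor_log x + i) \<le> x * 2 ^ i + r" unfolding power_add by (rule trans_le_add1)
  have "x + 1 \<le> 2 * 2 ^ floor_log x" using floor_log_exp2_gt[of x] by simp
  from mult_right_mono[OF this, of "2 ^ i"] x(2)
  show "x * 2 ^ i + r < 2 * 2 ^ (floor_log x + i)" by (simp add: power_add algebra_simps)
qed simp

lemma dyadic_mult_power2:
  assumes "x > 0" "r < 2 ^ i"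
  shows "dyadic (x * 2 ^ i + r) = (2 * x + (2 * r + 1) / 2 ^ i) / 2 ^ floor_log x"
proof -
  have eq: "2 * real (x * 2 ^ i + r) + 1 = 2 ^ i * (2 * x + (2 * r + 1) / 2 ^ i)"
    by (simp add: field_simps)
  show ?thesis
    unfolding dyadic_def floor_log_mult_power2[OF assms] eq power_add by simp
qed

text \<open>\<open>dyadic u\<close> is the midpoint of the interval with these endpoints, and its
  two halves are the intervals of the children. So the left descendants fill the lower half and the
  right ones the upper half, as the in-order requires.\<close>

lemma dyadic_subtree:
  assumes "y \<in> subtree u" "u > 0"
  shows "2 * real u / 2 ^ floor_log u < dyadic y" "dyadic y < (2 * real u + 2) / 2 ^ floor_log u"
proof -
  obtain i where "y div 2 ^ i = u" using assms(1) by (auto simp: subtree_def)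
  define r where "r = y mod 2 ^ i"
  have r: "r < 2 ^ i" by (simp add: r_def)
  have "y = u * 2 ^ i + r" using div_mult_mod_eq[of y "2 ^ i"] \<open>y div 2 ^ i = u\<close> by (simp add: r_def)
  then have y: "dyadic y = (2 * u + (2 * r + 1) / 2 ^ i) / 2 ^ floor_log u"
    using dyadic_mult_power2[OF assms(2) r] by simp
  have "2 * real r + 1 < 2 * 2 ^ i"
  proof -
    have "real (2 * r + 1) < real (2 * 2 ^ i)" using r unfolding of_nat_less_iff by simp
    then show ?thesis by simp
  qed
  then have upper: "(2 * real r + 1) / 2 ^ i < 2" by (simp add: pos_divide_less_eq)
  have lower: "(2 * real r + 1) / 2 ^ i > 0" by simp
  show "2 * real u / 2 ^ floor_log u < dyadic y"
    unfolding y by (rule divide_strict_right_mono) (use lower in simp_all)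
  show "dyadic y < (2 * real u + 2) / 2 ^ floor_log u"
    unfolding y by (rule divide_strict_right_mono) (use upper in \<open>simp_all add: add.commute\<close>)
qed

lemma left_subtree_less:
  assumes "y \<in> subtree (2 * u)" "u > 0"
  shows "dyadic y < dyadic u"
proof -
  have "(2 * real (2 * u) + 2) / 2 ^ floor_log (2 * u) = dyadic u"
    unfolding floor_log_twice[OF assms(2)[unfolded neq0_conv[symmetric]]] dyadic_def by (simp add: field_simps)
  with dyadic_subtree(2)[OF assms(1)] assms(2) show ?thesis by simp
qed

lemma floor_log_twice_Suc: "u > 0 \<Longrightarrow> floor_log (Suc (2 * u)) = Suc (floor_log u)"
  using floor_log_mult_power2[of u 1 1] by (simp add: mult.commute)

lemma right_subtree_greater:
  assumes "y \<in> subtree (Suc (2 * u))" "u > 0"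
  shows "dyadic u < dyadic y"
proof -
  have "2 * real (Suc (2 * u)) / 2 ^ floor_log (Suc (2 * u)) = dyadic u"
    unfolding floor_log_twice_Suc[OF assms(2)] dyadic_def by (simp add: field_simps)
  with dyadic_subtree(1)[OF assms(1)] show ?thesis by simp
qed

lemma dyadic_0: "dyadic 0 = 1"
  by (simp add: dyadic_def)

lemma dyadic_pos_ge:
  assumes "x > 0"
  shows "dyadic x > 2"
proof -
  have "real (2 ^ floor_log x) \<le> real x" using floor_log_exp2_le[OF assms] by (rule of_nat_mono)
  then have "2 * 2 ^ floor_log x < 2 * real x + 1" unfolding of_nat_power of_nat_numeral by linarith
  then show ?thesis by (simp add: dyadic_def pos_less_divide_eq del: of_nat_less_of_nat_power_cancel_iff)
qed

lemma mult_power2_in_subtree: "u * 2 ^ i \<in> subtree u"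
  unfolding subtree_def by (auto intro: exI[of _ i])

text \<open>Arbitrarily large z are wanted because z will be an index, and among unrealized numbers
  only indices beyond the stage are sure to be available. The witness lies far down the leftmost
  branch below the right child.\<close>

lemma inorder_no_greatest: "\<exists>z>N. dyadic x < dyadic z"
proof -
  define z where "z = Suc (2 * x) * 2 ^ Suc N"
  have "N < z"
  proof -
    have "N < 2 ^ Suc N" by (rule less_trans[OF less_exp]) simp
    also have "\<dots> \<le> z" unfolding z_def using mult_le_mono1[of 1 "Suc (2 * x)" "2 ^ Suc N"] by simp
    finally show ?thesis .
  qed
  moreover have "dyadic x < dyadic z"
  proof (cases "x = 0")
    case True
    then show ?thesis using dyadic_pos_ge[of z] \<open>N < z\<close> by (simp add: dyadic_0)
  next
    case False
    have "z \<in> subtree (Suc (2 * x))" unfolding z_def by (rule mult_power2_in_subtree)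
    then show ?thesis by (rule right_subtree_greater) (use False in simp)
  qed
  ultimately show ?thesis by blast
qed

lemma inorder_dense:
  assumes "dyadic x < dyadic y"
  shows "\<exists>z>N. dyadic x < dyadic z \<and> dyadic z < dyadic y"
proof (cases "x = 0")
  case True
  then have y: "y > 0" using assms by (cases "y = 0") auto
  \<comment> \<open>0 is not a node and has no right child; the witness is a left descendant of y
    instead.\<close>
  define z where "z = y * 2 ^ Suc N"
  have "N < 2 ^ Suc N" by (rule less_trans[OF less_exp]) simp
  also have "\<dots> \<le> z" using y by (simp add: z_def)
  finally have z: "N < z" .
  have "z \<in> subtree (2 * y)"
    unfolding subtree_def mem_Collect_eq by (rule exI[of _ N]) (simp add: z_def)
  then have "dyadic z < dyadic y" using y by (rule left_subtree_less)
  with z True dyadic_pos_ge[of z] show ?thesis by (auto simp: dyadic_0)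
next
  case False
  then have x: "x > 0" by simp
  have "y > 0" using assms dyadic_pos_ge[OF x] by (cases "y = 0") (auto simp: dyadic_0)
  \<comment> \<open>The summand N makes z large. The summand y puts z so deep that it is closer to x
    than y can be.\<close>
  define i where "i = N + y"
  define z where "z = Suc (2 * x) * 2 ^ i"
  have "N \<le> i" by (simp add: i_def)
  also have "i < 2 ^ i" by (rule less_exp)
  also have "\<dots> \<le> z" by (simp add: z_def)
  finally have z: "N < z" .
  have "z \<in> subtree (Suc (2 * x))" unfolding z_def by (rule mult_power2_in_subtree)
  then have xz: "dyadic x < dyadic z" using x by (rule right_subtree_greater)
  have "2 ^ floor_log y \<le> y" by (rule floor_log_exp2_le[OF \<open>y > 0\<close>])
  also have "y < 2 ^ Suc i" by (rule less_le_trans[OF less_exp power_increasing]) (simp_all add: i_def)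
  finally have "(2::real) ^ floor_log y < 2 ^ Suc i" by (metis of_nat_less_iff of_nat_numeral of_nat_power)
  then have small: "1 / (2 ^ floor_log x * 2 ^ Suc i) < 1 / (2 ^ floor_log x * (2::real) ^ floor_log y)"
    by (intro divide_strict_left_mono) simp_all
  have "dyadic z = (2 * real (2 * x + 1) + 1 / 2 ^ i) / 2 ^ Suc (floor_log x)"
    using dyadic_mult_power2[of "Suc (2 * x)" 0 i] x by (simp add: z_def floor_log_twice_Suc)
  also have "\<dots> = dyadic x + 1 / (2 ^ floor_log x * 2 ^ Suc i)"
    by (simp add: dyadic_def field_simps)
  also have "\<dots> < dyadic x + 1 / (2 ^ floor_log x * 2 ^ floor_log y)" using small by simp
  \<comment> \<open>Unequal integers differ by at least 1, so the cross products bound the gap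
    between x and y from below.\<close>
  also have "\<dots> \<le> dyadic y"
  proof -
    have "\<not> inorder y x" using assms by (simp add: inorder_iff)
    then have "Suc ((2 * x + 1) * 2 ^ floor_log y) \<le> (2 * y + 1) * 2 ^ floor_log x"
      unfolding inorder_def by simp
    then have "real (Suc ((2 * x + 1) * 2 ^ floor_log y)) \<le> real ((2 * y + 1) * 2 ^ floor_log x)"
      by (rule of_nat_mono)
    then have "((2 * real x + 1) * 2 ^ floor_log y + 1) / (2 ^ floor_log x * 2 ^ floor_log y) \<le>
        (2 * real y + 1) * 2 ^ floor_log x / (2 ^ floor_log x * 2 ^ floor_log y)"
      by (intro divide_right_mono) (simp_all add: algebra_simps)
    then show ?thesis by (simp add: dyadic_def add_divide_distrib)
  qed
  finally show ?thesis using z xz by blast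
qed

section \<open>Ancestors and descendants\<close>

lemma subtree_refl: "u \<in> subtree u"
  unfolding subtree_def by (auto intro: exI[of _ 0])

lemma subtree_trans:
  assumes "x \<in> subtree u" "y \<in> subtree x"
  shows "y \<in> subtree u"
proof -
  obtain i j where "x div 2 ^ i = u" "y div 2 ^ j = x" using assms by (auto simp: subtree_def)
  then have "y div 2 ^ (j + i) = u" by (simp add: power_add div_mult2_eq)
  then show ?thesis by (auto simp: subtree_def)
qed

lemma subtree_le: "y \<in> subtree u \<Longrightarrow> u \<le> y"
  by (auto simp: subtree_def)

lemma subtree_child: "2 * u \<in> subtree u" "Suc (2 * u) \<in> subtree u"
  unfolding subtree_def by (auto intro!: exI[of _ 1])

lemma subtree_cases:
  assumes "y \<in> subtree u"
  shows "y = u \<or> y \<in> subtree (2 * u) \<or> y \<in> subtree (Suc (2 * u))"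
proof -
  obtain i where i: "y div 2 ^ i = u" using assms by (auto simp: subtree_def)
  show ?thesis
  proof (cases i)
    case 0
    with i show ?thesis by simp
  next
    case (Suc j)
    have "y div 2 ^ j div 2 = u" using i unfolding Suc power_Suc2 by (simp add: div_mult2_eq)
    then have "y div 2 ^ j = 2 * u \<or> y div 2 ^ j = Suc (2 * u)" by linarith
    then show ?thesis by (auto simp: subtree_def)
  qed
qed

lemma subtree_1: "y > 0 \<Longrightarrow> y \<in> subtree 1"
proof (induction y rule: less_induct)
  case (less y)
  show ?case
  proof (cases "y = 1")
    case False
    with less.prems have "y div 2 \<in> subtree 1" by (intro less.IH) auto
    moreover have "y \<in> subtree (y div 2)" unfolding subtree_def by (auto intro: exI[of _ 1])
    ultimately show ?thesis by (rule subtree_trans)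
  qed (simp add: subtree_refl)
qed

lemma subtree_linear:
  assumes "y \<in> subtree u" "y \<in> subtree v"
  shows "u \<in> subtree v \<or> v \<in> subtree u"
proof -
  have *: "y div 2 ^ j \<in> subtree (y div 2 ^ i)" if "j \<le> i" for i j
  proof -
    have "y div 2 ^ i = y div 2 ^ j div 2 ^ (i - j)"
      using that by (simp add: div_mult2_eq[symmetric] power_add[symmetric])
    then show ?thesis by (auto simp: subtree_def)
  qed
  obtain i j where "y div 2 ^ i = u" "y div 2 ^ j = v" using assms by (auto simp: subtree_def)
  with * show ?thesis by (metis nat_le_linear)
qed

lemma subtree_iff_bounded: "u > 0 \<Longrightarrow> y \<in> subtree u \<longleftrightarrow> (\<exists>i\<le>y. y div 2 ^ i = u)"
proof
  assume u: "u > 0" and "y \<in> subtree u"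
  then obtain i where i: "y div 2 ^ i = u" by (auto simp: subtree_def)
  have "i \<le> y"
  proof (rule ccontr)
    assume "\<not> i \<le> y"
    then have "y < 2 ^ i" by (meson less_exp less_trans not_le)
    with i u show False by simp
  qed
  with i show "\<exists>i\<le>y. y div 2 ^ i = u" by blast
qed (auto simp: subtree_def)

lemma pr_fun_floor_log [pr_intros]:
  assumes "pr_fun G a"
  shows "pr_fun G (\<lambda>x. floor_log (a x))"
proof -
  have eq: "floor_log n = (LEAST k. n < 2 ^ Suc k)" for n
  proof (rule Least_equality[symmetric])
    show "n < 2 ^ Suc (floor_log n)" using floor_log_exp2_gt[of n] by simp
    fix k assume "n < 2 ^ Suc k"
    show "floor_log n \<le> k"
    proof (cases "n = 0")
      case False
      then have "(2::nat) ^ floor_log n < 2 ^ Suc k"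
        using floor_log_exp2_le[of n] \<open>n < 2 ^ Suc k\<close> by (meson le_less_trans not_gr_zero)
      then show ?thesis using power_less_imp_less_exp[of "2::nat" "floor_log n" "Suc k"] by simp
    qed simp
  qed
  have "\<exists>i\<le>a x. a x < 2 ^ Suc i" for x
    by (rule exI[of _ "a x"]) (use less_trans[OF less_exp[of "a x"]] in simp)
  then show ?thesis
    unfolding eq by (intro pr_fun_Least[where n = a] pr_intros pr_fun_comp[OF assms] assms)
qed

lemma pr_pred_inorder [pr_intros]:
  "pr_fun G a \<Longrightarrow> pr_fun G b \<Longrightarrow> pr_pred G (\<lambda>x. inorder (a x) (b x))"
  unfolding inorder_def by (intro pr_intros)


section \<open>A linear order whose cut hides a path of the tree\<close>

locale tree_path =
  fixes R :: "nat \<Rightarrow> nat \<Rightarrow> nat \<Rightarrow> bool"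
begin

definition turns_left :: "nat \<Rightarrow> bool" where
  "turns_left u \<longleftrightarrow> (\<forall>v. \<exists>w. R u v w)"

primrec path :: "nat \<Rightarrow> nat" where
  "path 0 = 1"
| "path (Suc m) = (if turns_left (path m) then 2 * path m else Suc (2 * path m))"

text \<open>A node \<open>y\<close> is good if every left turn above \<open>y\<close> has been confirmed up to \<open>y\<close>. The good nodes form
  a tree that contains the path, and only finitely many of them branch off the path to the left at a given
  node.\<close>

definition good :: "nat \<Rightarrow> nat \<Rightarrow> bool" where
  "good s y \<longleftrightarrow> 0 < y \<and> (\<forall>i\<le>y. 0 < y div 2 ^ i \<and> even (y div 2 ^ i) \<longrightarrow>
     (\<forall>v<y. \<exists>w\<le>s. R (y div 2 ^ i div 2) v w))"

text \<open>A number \<open>n\<close> codes a node, an index and a stage. If the stage is the first one at which the node is good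
  and some good node \<open>x\<close>, not to the right of it, is at least as large as the index, then \<open>n\<close> goes to the
  block of that node. All other numbers go to blocks further to the right.\<close>

definition supported :: "nat \<Rightarrow> nat \<Rightarrow> nat \<Rightarrow> bool" where
  "supported s u j \<longleftrightarrow> u \<le> s \<and> good s u \<and> (\<exists>x\<le>s. good s x \<and> inorder x u \<and> j \<le> x)"

definition realized :: "nat \<Rightarrow> bool" where
  "realized n \<longleftrightarrow> supported (psnd (psnd n)) (pfst n) (pfst (psnd n)) \<and>
     (\<forall>t<psnd (psnd n). \<not> supported t (pfst n) (pfst (psnd n)))"

text \<open>The block of an unrealized number keeps its node and stage, so that only the index
  varies; indices beyond the stage cannot be supported and thus all occur. Such a block may be the
  number 0, which is why the in-order has to make sense there.\<close>

definition block :: "nat \<Rightarrow> nat" where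
  "block n = (if realized n then pfst n else pair (pfst n) (psnd (psnd n)))"

text \<open>Lexicographic: realized numbers first, then the block, then the index, the last two in
  the in-order. A block with all indices is dense upwards from index 0, its least element.\<close>

definition order :: "nat \<Rightarrow> nat \<Rightarrow> bool" where
  "order x y \<longleftrightarrow> (if realized x \<longleftrightarrow> realized y
     then (if block x = block y then inorder (pfst (psnd x)) (pfst (psnd y)) else inorder (block x) (block y))
     else realized x)"

definition right_of_path :: "nat \<Rightarrow> bool" where
  "right_of_path y \<longleftrightarrow> (\<exists>m. turns_left (path m) \<and> (y = path m \<or> y \<in> subtree (Suc (2 * path m))))"

definition left_of_path :: "nat \<Rightarrow> bool" where
  "left_of_path y \<longleftrightarrow> (\<exists>m. \<not> turns_left (path m) \<and> (y = path m \<or> y \<in> subtree (2 * path m)))"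

section \<open>The path and the nodes on either side of it\<close>

lemma subtree_of_left_child: "y \<in> subtree (2 * u) \<Longrightarrow> y \<in> subtree u"
  by (rule subtree_trans[OF subtree_child(1)])

lemma subtree_of_right_child: "y \<in> subtree (Suc (2 * u)) \<Longrightarrow> y \<in> subtree u"
  by (rule subtree_trans[OF subtree_child(2)])

lemma path_pos: "path m > 0"
  by (induction m) auto

lemma path_less_Suc: "path m < path (Suc m)"
  using path_pos[of m] by auto

lemma strict_mono_path: "strict_mono path"
  using path_less_Suc by (rule strict_mono_Suc_iff[THEN iffD2, rule_format])

lemma path_subtree: "m \<le> m' \<Longrightarrow> path m' \<in> subtree (path m)"
proof (induction rule: dec_induct)
  case (step n)
  have "path (Suc n) \<in> subtree (path n)" by (simp add: subtree_child)
  with step.IH show ?case by (rule subtree_trans)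
qed (rule subtree_refl)

lemma path_subtree_less:
  assumes "m < m'"
  shows "path m' \<in> subtree (path (Suc m))"
  using assms by (intro path_subtree) simp

lemma good_iff:
  "good s y \<longleftrightarrow> 0 < y \<and> (\<forall>u>0. y \<in> subtree (2 * u) \<longrightarrow> (\<forall>v<y. \<exists>w\<le>s. R u v w))"
proof (intro iffI conjI allI impI)
  fix u v assume "good s y" "0 < u" "y \<in> subtree (2 * u)" "v < y"
  then show "\<exists>w\<le>s. R u v w"
    using subtree_iff_bounded[of "2 * u" y] by (auto simp: good_def)
next
  assume *: "0 < y \<and> (\<forall>u>0. y \<in> subtree (2 * u) \<longrightarrow> (\<forall>v<y. \<exists>w\<le>s. R u v w))"
  show "good s y"
    unfolding good_def
  proof (intro conjI allI impI)
    fix i v assume i: "0 < y div 2 ^ i \<and> even (y div 2 ^ i)" and "v < y"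
    then have "y \<in> subtree (2 * (y div 2 ^ i div 2))" "0 < y div 2 ^ i div 2"
      by (auto simp: subtree_def intro!: exI[of _ i] elim!: evenE)
    with * \<open>v < y\<close> show "\<exists>w\<le>s. R (y div 2 ^ i div 2) v w" by blast
  qed (use * in simp)
qed (simp add: good_def)

lemma good_mono: "good s y \<Longrightarrow> s \<le> t \<Longrightarrow> good t y"
  unfolding good_iff using le_trans by blast

text \<open>Left turns above an ancestor are left turns above the node, and a smaller number asks
  for fewer confirmations.\<close>

lemma good_ancestor:
  assumes "good s y" "y \<in> subtree u" "u > 0"
  shows "good s u"
  unfolding good_iff
proof (intro conjI allI impI)
  fix x v assume x: "0 < x" "u \<in> subtree (2 * x)" and v: "v < u"
  have "y \<in> subtree (2 * x)" by (rule subtree_trans[OF x(2) assms(2)])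
  moreover have "v < y" using v subtree_le[OF assms(2)] by simp
  ultimately show "\<exists>w\<le>s. R x v w" using assms(1) x(1) unfolding good_iff by blast
qed (rule assms(3))

lemma ancestor_of_path:
  assumes "u > 0" "path m \<in> subtree u"
  shows "\<exists>k\<le>m. u = path k"
  using assms(2)
proof (induction m)
  case 0
  then have "u \<le> 1" using subtree_le by force
  with assms(1) show ?case by auto
next
  case (Suc m)
  show ?case
  proof (cases "u = path (Suc m)")
    case False
    have "path (Suc m) div 2 = path m" by auto
    moreover obtain i where i: "path (Suc m) div 2 ^ i = u" using Suc.prems by (auto simp: subtree_def)
    moreover from False i obtain j where "i = Suc j" by (cases i) auto
    ultimately have "path m div 2 ^ j = u" by (metis div_mult2_eq power_Suc)
    then have "path m \<in> subtree u" by (auto simp: subtree_def)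
    with Suc.IH show ?thesis by (meson le_Suc_eq)
  qed auto
qed

lemma path_turns_left:
  assumes "path m \<in> subtree (2 * u)" "u > 0"
  shows "turns_left u"
proof -
  obtain k where k: "2 * u = path k" using ancestor_of_path[of "2 * u" m] assms by auto
  then obtain l where l: "k = Suc l" by (cases k) auto
  with k have "2 * u = (if turns_left (path l) then 2 * path l else Suc (2 * path l))" by simp
  then show ?thesis by (cases "turns_left (path l)") (simp_all, presburger)
qed

lemma turns_left_bound: "turns_left u \<Longrightarrow> \<exists>s. \<forall>v<n. \<exists>w\<le>s. R u v w"
proof (induction n)
  case (Suc n)
  then obtain s where "\<forall>v<n. \<exists>w\<le>s. R u v w" by blast
  moreover obtain w where "R u n w" using Suc.prems by (auto simp: turns_left_def)
  ultimately show ?case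
    by (intro exI[of _ "max s w"]) (auto simp: less_Suc_eq le_max_iff_disj)
qed simp

text \<open>A left child on or above the path node was entered by a left turn of the path, so all
  the witnesses exist. Only finitely many are asked for, and one stage bounds them.\<close>

lemma good_path: "\<exists>s. good s (path m)"
proof -
  let ?y = "path m"
  have "\<exists>s. \<forall>u<n. 0 < u \<and> ?y \<in> subtree (2 * u) \<longrightarrow> (\<forall>v<?y. \<exists>w\<le>s. R u v w)" for n
  proof (induction n)
    case (Suc n)
    then obtain s where s: "\<forall>u<n. 0 < u \<and> ?y \<in> subtree (2 * u) \<longrightarrow> (\<forall>v<?y. \<exists>w\<le>s. R u v w)" by blast
    obtain t where t: "0 < n \<and> ?y \<in> subtree (2 * n) \<longrightarrow> (\<forall>v<?y. \<exists>w\<le>t. R n v w)"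
      using path_turns_left turns_left_bound by blast
    have "\<forall>u<Suc n. 0 < u \<and> ?y \<in> subtree (2 * u) \<longrightarrow> (\<forall>v<?y. \<exists>w\<le>max s t. R u v w)"
    proof (intro allI impI, elim conjE)
      fix u v assume u: "u < Suc n" "0 < u" "?y \<in> subtree (2 * u)" and v: "v < ?y"
      show "\<exists>w\<le>max s t. R u v w"
      proof (cases "u = n")
        case True
        with t u v have "\<exists>w\<le>t. R u v w" by blast
        then show ?thesis by (auto simp: le_max_iff_disj)
      next
        case False
        with s u v have "\<exists>w\<le>s. R u v w" by (simp add: less_Suc_eq)
        then show ?thesis by (auto simp: le_max_iff_disj)
      qed
    qed
    then show ?case by blast
  qed simp
  from this[of "Suc ?y"] obtain s where
    s: "\<And>u. u < Suc ?y \<Longrightarrow> 0 < u \<Longrightarrow> ?y \<in> subtree (2 * u) \<Longrightarrow> \<forall>v<?y. \<exists>w\<le>s. R u v w" by blast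
  have "u < Suc ?y" if "?y \<in> subtree (2 * u)" for u using subtree_le[OF that] by simp
  with s path_pos show ?thesis unfolding good_iff by blast
qed

text \<open>Otherwise y would be a descendant of every path node, but descendants are never smaller
  and the path is unbounded.\<close>

lemma left_or_right_of_path:
  assumes "y > 0"
  shows "left_of_path y \<or> right_of_path y"
proof (rule ccontr)
  assume none: "\<not> (left_of_path y \<or> right_of_path y)"
  have "y \<in> subtree (path m)" for m
  proof (induction m)
    case 0
    then show ?case using subtree_1[OF assms] by simp
  next
    case (Suc m)
    with subtree_cases[OF Suc] none show ?case
      by (auto simp: left_of_path_def right_of_path_def)
  qed
  then have "path (Suc y) \<le> y" using subtree_le by blast
  moreover have "Suc y \<le> path (Suc y)" by (rule strict_mono_imp_increasing[OF strict_mono_path])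
  ultimately show False by simp
qed

text \<open>The node that leaves the path first decides: the other one and the rest of the path stay
  on one side of that branching.\<close>

lemma left_less_right:
  assumes "left_of_path x" "right_of_path y"
  shows "dyadic x < dyadic y"
proof -
  obtain m where m: "\<not> turns_left (path m)" "x = path m \<or> x \<in> subtree (2 * path m)"
    using assms(1) by (auto simp: left_of_path_def)
  obtain k where k: "turns_left (path k)" "y = path k \<or> y \<in> subtree (Suc (2 * path k))"
    using assms(2) by (auto simp: right_of_path_def)
  have x: "x \<in> subtree (path m)" "dyadic x \<le> dyadic (path m)"
    using m(2) left_subtree_less[of x "path m"] path_pos[of m]
    by (auto intro: subtree_refl subtree_of_left_child)
  have y: "y \<in> subtree (path k)" "dyadic (path k) \<le> dyadic y"
    using k(2) right_subtree_greater[of y "path k"] path_pos[of k]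
    by (auto intro: subtree_refl subtree_of_right_child)
  show ?thesis
  proof (cases m k rule: linorder_cases)
    case less
    have "y \<in> subtree (path (Suc m))" by (rule subtree_trans[OF path_subtree_less[OF less] y(1)])
    then have "dyadic (path m) < dyadic y" using m(1) right_subtree_greater[of y "path m"] path_pos[of m] by simp
    with x(2) show ?thesis by simp
  next
    case equal
    with m k show ?thesis by simp
  next
    case greater
    have "x \<in> subtree (path (Suc k))" by (rule subtree_trans[OF path_subtree_less[OF greater] x(1)])
    then have "dyadic x < dyadic (path k)" using k(1) left_subtree_less[of x "path k"] path_pos[of k] by simp
    with y(2) show ?thesis by simp
  qed
qed

lemma not_left_and_right: "left_of_path x \<Longrightarrow> right_of_path x \<Longrightarrow> False"
  using left_less_right by blast

lemma right_of_path_above_path: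
  assumes "right_of_path y"
  shows "\<exists>m. \<forall>k>m. dyadic (path k) < dyadic y"
proof -
  obtain m where m: "turns_left (path m)" "y = path m \<or> y \<in> subtree (Suc (2 * path m))"
    using assms by (auto simp: right_of_path_def)
  have y: "dyadic (path m) \<le> dyadic y"
    using m(2) right_subtree_greater[of y "path m"] path_pos[of m] by auto
  have "dyadic (path k) < dyadic y" if "m < k" for k
    using path_subtree_less[OF that] m(1) left_subtree_less[of "path k" "path m"] path_pos[of m] y by simp
  then show ?thesis by blast
qed

text \<open>Where the path turns right, some v has no witness, so good nodes below the left child
  are at most v. A node not beyond u must have left the path no later than u did, which leaves
  finitely many finite sets.\<close>

lemma finite_good_left:
  assumes "left_of_path u"
  shows "finite {y. (\<exists>s. good s y) \<and> inorder y u}"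
proof -
  obtain m where m: "\<not> turns_left (path m)" "u = path m \<or> u \<in> subtree (2 * path m)"
    using assms by (auto simp: left_of_path_def)
  then have u: "dyadic u \<le> dyadic (path m)"
    using left_subtree_less[of u "path m"] path_pos[of m] by auto
  let ?F = "\<lambda>k. {y. (\<exists>s. good s y) \<and> \<not> turns_left (path k) \<and> (y = path k \<or> y \<in> subtree (2 * path k))}"
  have "finite (?F k)" for k
  proof (cases "turns_left (path k)")
    case False
    then obtain v where v: "\<And>w. \<not> R (path k) v w" by (auto simp: turns_left_def)
    have "y \<le> v" if "good s y" "y \<in> subtree (2 * path k)" for s y
    proof (rule ccontr)
      assume "\<not> y \<le> v"
      then have "v < y" by simp
      with that(1) have "path k > 0 \<longrightarrow> y \<in> subtree (2 * path k) \<longrightarrow> (\<exists>w\<le>s. R (path k) v w)"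
        by (simp add: good_iff)
      with that(2) path_pos[of k] v show False by simp
    qed
    then have "?F k \<subseteq> insert (path k) {..v}" by auto
    then show ?thesis by (rule finite_subset) simp
  qed simp
  moreover have "{y. (\<exists>s. good s y) \<and> inorder y u} \<subseteq> (\<Union>k\<le>m. ?F k)"
  proof
    fix y assume y: "y \<in> {y. (\<exists>s. good s y) \<and> inorder y u}"
    then have "y > 0" "dyadic y \<le> dyadic u" by (auto simp: good_def inorder_iff)
    then have "left_of_path y"
      using left_or_right_of_path[of y] left_less_right[OF assms, of y] by auto
    then obtain k where k: "\<not> turns_left (path k)" "y = path k \<or> y \<in> subtree (2 * path k)"
      by (auto simp: left_of_path_def)
    have "k \<le> m"
    proof (rule ccontr)
      assume "\<not> k \<le> m"
      then have "path k \<in> subtree (path (Suc m))" by (intro path_subtree_less) simp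
      moreover have "y \<in> subtree (path k)"
        using k(2) by (auto intro: subtree_refl subtree_of_left_child)
      ultimately have "y \<in> subtree (path (Suc m))" by (rule subtree_trans)
      then have "dyadic (path m) < dyadic y" using m(1) right_subtree_greater[of y "path m"] path_pos[of m] by simp
      with u \<open>dyadic y \<le> dyadic u\<close> show False by simp
    qed
    with k y show "y \<in> (\<Union>k\<le>m. ?F k)" by auto
  qed
  moreover have "finite (\<Union>k\<le>m. ?F k)" using calculation(1) by (intro finite_UN_I) simp_all
  ultimately show ?thesis using finite_subset by blast
qed

section \<open>Realized numbers and the blocks of the order\<close>

lemma triple_eqI:
  assumes "pfst x = pfst y" "pfst (psnd x) = pfst (psnd y)" "psnd (psnd x) = psnd (psnd y)"
  shows "x = y"
proof -
  have "x = pair (pfst x) (pair (pfst (psnd x)) (psnd (psnd x)))" by simp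
  also have "\<dots> = y" unfolding assms by simp
  finally show ?thesis .
qed

lemma realized_unique:
  assumes "realized x" "realized y" "pfst x = pfst y" "pfst (psnd x) = pfst (psnd y)"
  shows "x = y"
proof (rule triple_eqI[OF assms(3,4)])
  have x: "supported (psnd (psnd x)) (pfst y) (pfst (psnd y))"
    "\<And>t. t < psnd (psnd x) \<Longrightarrow> \<not> supported t (pfst y) (pfst (psnd y))"
    using assms(1) unfolding realized_def assms(3,4) by simp_all
  have y: "supported (psnd (psnd y)) (pfst y) (pfst (psnd y))"
    "\<And>t. t < psnd (psnd y) \<Longrightarrow> \<not> supported t (pfst y) (pfst (psnd y))"
    using assms(2) unfolding realized_def by simp_all
  show "psnd (psnd x) = psnd (psnd y)"
    using x(1) y(1) x(2)[of "psnd (psnd y)"] y(2)[of "psnd (psnd x)"]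
    by (cases "psnd (psnd x)" "psnd (psnd y)" rule: linorder_cases) simp_all
qed

lemma ex_realized:
  assumes "supported s u j"
  shows "\<exists>t\<le>s. realized (pair u (pair j t))"
proof -
  define t where "t = (LEAST t. supported t u j)"
  have "supported t u j"
    unfolding t_def by (rule LeastI[of "\<lambda>t. supported t u j", OF assms])
  moreover have "\<not> supported t' u j" if "t' < t" for t'
    using that unfolding t_def by (rule not_less_Least)
  ultimately have "realized (pair u (pair j t))" unfolding realized_def by simp
  moreover have "t \<le> s"
    unfolding t_def by (rule Least_le[of "\<lambda>t. supported t u j", OF assms])
  ultimately show ?thesis by blast
qed

lemma ex_supported:
  assumes "good s u" "good t x" "inorder x u" "j \<le> x"
  shows "\<exists>s. supported s u j"
proof -
  let ?s = "s + t + x + u"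
  have "good ?s u" "good ?s x" using assms by (auto intro: good_mono)
  with assms(3,4) show ?thesis unfolding supported_def by (intro exI[of _ ?s] conjI exI[of _ x]) simp_all
qed

lemma realized_path: "\<exists>t. realized (pair (path m) (pair 0 t))"
proof -
  obtain s where "good s (path m)" using good_path by blast
  from ex_supported[OF this this inorder_refl le0] obtain t where "supported t (path m) 0" by blast
  from ex_realized[OF this] show ?thesis by blast
qed

text \<open>From some level on the path runs to the left of u. Its nodes are good and arbitrarily
  large, so every index finds a supporting node.\<close>

lemma realized_right:
  assumes "good s u" "right_of_path u"
  shows "\<exists>t. realized (pair u (pair j t))"
proof -
  obtain m where m: "\<And>k. k > m \<Longrightarrow> dyadic (path k) < dyadic u"
    using right_of_path_above_path[OF assms(2)] by blast
  let ?k = "Suc (m + j)"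
  have "inorder (path ?k) u" using m[of ?k] by (simp add: inorder_iff)
  moreover have "j \<le> path ?k"
    using strict_mono_imp_increasing[OF strict_mono_path, of ?k] by simp
  moreover obtain t where "good t (path ?k)" using good_path by blast
  ultimately obtain s where "supported s u j" using ex_supported[OF assms(1)] by metis
  from ex_realized[OF this] show ?thesis by blast
qed

lemma realized_good: "realized x \<Longrightarrow> good (psnd (psnd x)) (pfst x)"
  by (simp add: realized_def supported_def)

lemma order_omega_part: "x \<in> omega_part order \<longleftrightarrow> realized x \<and> left_of_path (pfst x)"
proof
  assume x: "realized x \<and> left_of_path (pfst x)"
  define F where "F = {y. (\<exists>s. good s y) \<and> inorder y (pfst x)}"
  have F: "finite F" using finite_good_left x by (simp add: F_def)
  let ?l = "\<lambda>y. (pfst y, pfst (psnd y))"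
  \<comment> \<open>The node supporting y is good and not beyond the node of x, so it lies in
    \<open>F\<close> and bounds the index. Since node and index determine a realized number,
    finiteness follows.\<close>
  have sub: "realized y \<and> ?l y \<in> F \<times> {..Max F}" if "order y x" for y
  proof -
    have y: "realized y" using that x by (auto simp: order_def split: if_splits)
    with that x have le: "inorder (pfst y) (pfst x)"
      by (auto simp: order_def block_def inorder_refl split: if_splits)
    from y obtain z where z: "good (psnd (psnd y)) z" "inorder z (pfst y)" "pfst (psnd y) \<le> z"
      by (auto simp: realized_def supported_def)
    with le have "z \<in> F" unfolding F_def by (auto simp: inorder_iff intro: order_trans)
    with F have "z \<le> Max F" by (rule Max_ge)
    with z(3) le realized_good[OF y] y show ?thesis by (auto simp: F_def)
  qed
  have "inj_on ?l {y. order y x}"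
    using sub realized_unique by (intro inj_onI) auto
  moreover have "?l ` {y. order y x} \<subseteq> F \<times> {..Max F}" using sub by blast
  then have "finite (?l ` {y. order y x})" by (rule finite_subset) (use F in simp)
  ultimately have "finite {y. order y x}" using finite_imageD by blast
  then show "x \<in> omega_part order" by (simp add: omega_part_def)
next
  assume x: "x \<in> omega_part order"
  show "realized x \<and> left_of_path (pfst x)"
  proof (rule ccontr)
    assume nx: "\<not> ?thesis"
    \<comment> \<open>In the remaining cases the index 0 elements of almost all path nodes lie below
      x.\<close>
    obtain t where t: "\<And>m. realized (pair (path m) (pair 0 (t m)))" using realized_path by metis
    have "\<exists>m. \<forall>k>m. order (pair (path k) (pair 0 (t k))) x"
    proof (cases "realized x")
      case False
      with t show ?thesis by (auto simp: order_def)
    next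
      case True
      then have "pfst x > 0" using realized_good[of x] by (simp add: good_def)
      with True nx left_or_right_of_path have "right_of_path (pfst x)" by blast
      then obtain m where m: "\<And>k. k > m \<Longrightarrow> dyadic (path k) < dyadic (pfst x)"
        using right_of_path_above_path by blast
      have "order (pair (path k) (pair 0 (t k))) x" if "k > m" for k
        using m[OF that] t[of k] True by (auto simp: order_def block_def inorder_iff)
      then show ?thesis by blast
    qed
    then obtain m where "(\<lambda>k. pair (path k) (pair 0 (t k))) ` {m<..} \<subseteq> {y. order y x}" by blast
    moreover have "inj_on (\<lambda>k. pair (path k) (pair 0 (t k))) {m<..}"
      using strict_mono_eq[OF strict_mono_path] by (intro inj_onI) simp
    ultimately have "finite {m<..}" using x finite_subset finite_imageD
      unfolding omega_part_def mem_Collect_eq by blast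
    then show False by (simp add: infinite_Ioi)
  qed
qed

text \<open>Two reasons for one conclusion: the block of a node right of the path realizes every
  index, and an unrealized number stays unrealized when its index is raised above its stage, because
  a supporting node is bounded by the stage.\<close>

lemma order_next:
  assumes "x \<notin> omega_part order" "\<And>N. \<exists>j>N. P j"
  shows "\<exists>z j. P j \<and> pfst (psnd z) = j \<and> (realized z \<longleftrightarrow> realized x) \<and> block z = block x"
proof (cases "realized x")
  case True
  note good = realized_good[OF True]
  then have "right_of_path (pfst x)"
    using assms(1) True left_or_right_of_path by (auto simp: order_omega_part good_def)
  moreover obtain j where "P j" using assms(2) by blast
  moreover obtain t where "realized (pair (pfst x) (pair j t))"
    using realized_right[OF good] calculation(1) by blast
  ultimately show ?thesis
    using True by (intro exI[of _ "pair (pfst x) (pair j t)"] exI[of _ j]) (simp add: block_def)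
next
  case False
  obtain j where j: "P j" "psnd (psnd x) < j" using assms(2) by blast
  have "\<not> realized (pair (pfst x) (pair j (psnd (psnd x))))"
    using j(2) by (auto simp: realized_def supported_def)
  with False j(1) show ?thesis
    by (intro exI[of _ "pair (pfst x) (pair j (psnd (psnd x)))"] exI[of _ j]) (simp add: block_def)
qed

end

text \<open>Infinitely many left turns leave the \<eta>-part without a least element; infinitely
  many right turns make the \<omega>-part infinite.\<close>

locale path_order = tree_path +
  assumes pr_R: "pr_pred {} (\<lambda>p. R (pfst p) (pfst (psnd p)) (psnd (psnd p)))"
    and often_left: "\<exists>k>m. turns_left (path k)"
    and often_right: "\<exists>k>m. \<not> turns_left (path k)"
begin

lemma pr_pred_good [pr_intros]:
  assumes "pr_fun {} a" "pr_fun {} b"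
  shows "pr_pred {} (\<lambda>x. good (a x) (b x))"
proof -
  have R: "pr_pred {} (\<lambda>x. R (f x) (g x) (h x))" if "pr_fun {} f" "pr_fun {} g" "pr_fun {} h" for f g h
    using pr_pred_comp[OF pr_R pr_fun_pair[OF that(1) pr_fun_pair[OF that(2,3)]]] by simp
  show ?thesis
    unfolding good_def by (intro pr_intros R pr_fun_comp[OF assms(1)] pr_fun_comp[OF assms(2)] assms)
qed

lemma pr_pred_supported [pr_intros]:
  assumes "pr_fun {} a" "pr_fun {} b" "pr_fun {} c"
  shows "pr_pred {} (\<lambda>x. supported (a x) (b x) (c x))"
  unfolding supported_def
  by (intro pr_intros pr_fun_comp[OF assms(1)] pr_fun_comp[OF assms(2)] pr_fun_comp[OF assms(3)] assms)

lemma pr_pred_realized [pr_intros]: "pr_fun {} a \<Longrightarrow> pr_pred {} (\<lambda>x. realized (a x))"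
  by (rule pr_pred_comp) (unfold realized_def, intro pr_intros)

lemma pr_fun_block [pr_intros]: "pr_fun {} a \<Longrightarrow> pr_fun {} (\<lambda>x. block (a x))"
  by (rule pr_fun_comp) (unfold block_def, intro pr_intros)

lemma punctual_order: "punctual order"
proof -
  have "order x y \<longleftrightarrow> ((realized x \<longleftrightarrow> realized y) \<and>
      (block x = block y \<and> inorder (pfst (psnd x)) (pfst (psnd y)) \<or>
       block x \<noteq> block y \<and> inorder (block x) (block y))) \<or>
      \<not> (realized x \<longleftrightarrow> realized y) \<and> realized x" for x y
    by (auto simp: order_def)
  then show ?thesis unfolding punctual_iff by (simp only:) (intro pr_intros)
qed

lemma realized_omega_part:
  "realized x \<Longrightarrow> x \<in> omega_part order \<longleftrightarrow> \<not> right_of_path (pfst x)"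
  using order_omega_part left_or_right_of_path not_left_and_right realized_good by (metis good_def)

lemma omega_eta_order: "omega_eta order"
proof
  show "order x x" for x by (simp add: order_def inorder_refl)
  show "order x z" if "order x y" "order y z" for x y z
    using that unfolding order_def inorder_iff
    by (cases "realized x"; cases "realized y"; cases "realized z";
        cases "block x = block y"; cases "block y = block z") auto
  show "x = y" if "order x y" "order y x" for x y
  proof -
    from that have r: "realized x \<longleftrightarrow> realized y" by (auto simp: order_def split: if_splits)
    from that have b: "block x = block y"
      unfolding order_def inorder_iff by (auto simp: r split: if_splits)
    from that r b have i: "pfst (psnd x) = pfst (psnd y)"
      unfolding order_def inorder_iff by (auto split: if_splits)
    show ?thesis
    proof (cases "realized x")
      case True
      with r b i show ?thesis by (auto simp: block_def intro: realized_unique)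
    next
      case False
      with r b have "pair (pfst x) (psnd (psnd x)) = pair (pfst y) (psnd (psnd y))"
        unfolding block_def by simp
      then have "pfst x = pfst y" "psnd (psnd x) = psnd (psnd y)" unfolding pair_eq_iff by blast+
      then show ?thesis by (rule triple_eqI[OF _ i])
    qed
  qed
  show "order x y \<or> order y x" for x y
    unfolding order_def inorder_iff by (auto split: if_splits)
  obtain t where t: "\<And>m. realized (pair (path m) (pair 0 (t m)))" using realized_path by metis
  show "infinite (omega_part order)"
  proof -
    have "infinite {k. \<not> turns_left (path k)}"
      using often_right by (simp add: infinite_nat_iff_unbounded)
    moreover have "inj_on (\<lambda>k. pair (path k) (pair 0 (t k))) {k. \<not> turns_left (path k)}"
      using strict_mono_eq[OF strict_mono_path] by (intro inj_onI) simp
    moreover have "(\<lambda>k. pair (path k) (pair 0 (t k))) ` {k. \<not> turns_left (path k)} \<subseteq> omega_part order"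
      using t by (auto simp: order_omega_part left_of_path_def)
    ultimately show ?thesis by (meson finite_imageD finite_subset)
  qed
  show "\<exists>x. x \<notin> omega_part order"
  proof -
    obtain k where "turns_left (path k)" using often_left by blast
    then have "right_of_path (path k)" by (auto simp: right_of_path_def)
    then have "pair (path k) (pair 0 (t k)) \<notin> omega_part order"
      using realized_omega_part[OF t[of k]] by simp
    then show ?thesis ..
  qed
  fix x assume x: "x \<notin> omega_part order"
  show "\<exists>y. y \<notin> omega_part order \<and> order y x \<and> y \<noteq> x"
  proof -
    have "\<exists>m. \<forall>k>m. order (pair (path k) (pair 0 (t k))) x \<and> pair (path k) (pair 0 (t k)) \<noteq> x"
    proof (cases "realized x")
      case False
      with t have "order (pair (path k) (pair 0 (t k))) x \<and> pair (path k) (pair 0 (t k)) \<noteq> x" for k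
        by (auto simp: order_def)
      then show ?thesis by blast
    next
      case True
      with x realized_omega_part have "right_of_path (pfst x)" by blast
      then obtain m where m: "\<And>k. k > m \<Longrightarrow> dyadic (path k) < dyadic (pfst x)"
        using right_of_path_above_path by blast
      have "order (pair (path k) (pair 0 (t k))) x \<and> pair (path k) (pair 0 (t k)) \<noteq> x" if "k > m" for k
        using m[OF that] t[of k] True by (auto simp: order_def block_def inorder_iff)
      then show ?thesis by blast
    qed
    then obtain m where m: "\<And>k. k > m \<Longrightarrow>
      order (pair (path k) (pair 0 (t k))) x \<and> pair (path k) (pair 0 (t k)) \<noteq> x" by blast
    obtain k where k: "k > m" "turns_left (path k)" using often_left by blast
    then have "right_of_path (path k)" by (auto simp: right_of_path_def)
    with t[of k] realized_omega_part have "pair (path k) (pair 0 (t k)) \<notin> omega_part order" by simp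
    with m[OF k(1)] show ?thesis by blast
  qed
  have up: "\<exists>z. order x z \<and> z \<noteq> x \<and> (realized z \<longleftrightarrow> realized x) \<and> block z = block x"
  proof -
    have "\<exists>j>N. dyadic (pfst (psnd x)) < dyadic j" for N by (rule inorder_no_greatest)
    from order_next[OF x, of "\<lambda>j. dyadic (pfst (psnd x)) < dyadic j", OF this]
    obtain z where z: "dyadic (pfst (psnd x)) < dyadic (pfst (psnd z))"
      "realized z \<longleftrightarrow> realized x" "block z = block x" by blast
    then have "order x z" "z \<noteq> x" by (auto simp: order_def inorder_iff)
    with z show ?thesis by blast
  qed
  then show "\<exists>y. order x y \<and> y \<noteq> x" by blast
  fix y assume xy: "order x y" "x \<noteq> y" and y: "y \<notin> omega_part order"
  show "\<exists>z. order x z \<and> order z y \<and> z \<noteq> x \<and> z \<noteq> y"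
  proof (cases "(realized x \<longleftrightarrow> realized y) \<and> block x = block y")
    case True
    have "pfst (psnd x) \<noteq> pfst (psnd y)"
    proof
      assume i: "pfst (psnd x) = pfst (psnd y)"
      with True have "order y x" by (simp add: order_def inorder_refl)
      show False
      proof (cases "realized x")
        case r: True
        with True i xy(2) realized_unique show False by (auto simp: block_def)
      next
        case False
        with True have "pair (pfst x) (psnd (psnd x)) = pair (pfst y) (psnd (psnd y))"
          unfolding block_def by simp
        then have "pfst x = pfst y" "psnd (psnd x) = psnd (psnd y)" unfolding pair_eq_iff by blast+
        then have "x = y" by (rule triple_eqI[OF _ i])
        with xy(2) show False by simp
      qed
    qed
    with True xy(1) have "dyadic (pfst (psnd x)) < dyadic (pfst (psnd y))"
      by (simp add: order_def inorder_iff order_less_le)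
    then have "\<exists>j>N. dyadic (pfst (psnd x)) < dyadic j \<and> dyadic j < dyadic (pfst (psnd y))" for N
      by (rule inorder_dense)
    from order_next[OF x, of "\<lambda>j. dyadic (pfst (psnd x)) < dyadic j \<and> dyadic j < dyadic (pfst (psnd y))", OF this]
    obtain z where z: "dyadic (pfst (psnd x)) < dyadic (pfst (psnd z))"
      "dyadic (pfst (psnd z)) < dyadic (pfst (psnd y))"
      "realized z \<longleftrightarrow> realized x" "block z = block x" by blast
    with True have "order x z" "z \<noteq> x" "order z y" "z \<noteq> y" by (auto simp: order_def inorder_iff)
    then show ?thesis by blast
  next
    case False
    \<comment> \<open>In different blocks, any larger element of the block of x is still below
      y.\<close>
    obtain z where z: "order x z" "z \<noteq> x" "realized z \<longleftrightarrow> realized x" "block z = block x"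
      using up by blast
    with False xy(1) have "order z y" "z \<noteq> y" by (auto simp: order_def split: if_splits)
    with z show ?thesis by blast
  qed
qed

end


section \<open>A decidable copy\<close>

text \<open>An odd x stands for the node \<open>Suc (x div 2)\<close>; the nodes in in-order already
  form a copy of \<eta>. Parity decides the part, and the left child supplies a smaller
  element.\<close>

definition std_order :: "nat \<Rightarrow> nat \<Rightarrow> bool" where
  "std_order x y \<longleftrightarrow> even x \<and> (even y \<longrightarrow> x \<le> y) \<or>
     odd x \<and> odd y \<and> inorder (Suc (x div 2)) (Suc (y div 2))"

lemma punctual_std_order: "punctual std_order"
  unfolding punctual_iff std_order_def by (intro pr_intros)

lemma omega_part_std_order: "x \<in> omega_part std_order \<longleftrightarrow> even x"
proof
  assume "even x"
  then have "{y. std_order y x} \<subseteq> {..x}" by (auto simp: std_order_def)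
  then show "x \<in> omega_part std_order" unfolding omega_part_def mem_Collect_eq
    by (rule finite_subset) simp
next
  assume x: "x \<in> omega_part std_order"
  show "even x"
  proof (rule ccontr)
    assume "odd x"
    then have "range (\<lambda>n. 2 * n) \<subseteq> {y. std_order y x}" by (auto simp: std_order_def)
    with x have "finite (range (\<lambda>n::nat. 2 * n))"
      unfolding omega_part_def mem_Collect_eq by (rule finite_subset[rotated])
    then show False using finite_imageD[of "\<lambda>n::nat. 2 * n" UNIV] by (simp add: inj_def)
  qed
qed

text \<open>With \<open>x = 2 * u + 1\<close> standing for the node u + 1, its left child 2 * u + 2
  is represented by 4 * u + 3, which is \<open>Suc (2 * x)\<close>.\<close>

lemma std_order_left_child:
  assumes "odd x"
  shows "std_order (Suc (2 * x)) x"
proof -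
  obtain u where u: "x = Suc (2 * u)" using assms by (auto elim!: oddE)
  have "2 * Suc u \<in> subtree (2 * Suc u)" by (rule subtree_refl)
  from left_subtree_less[OF this] have "dyadic (2 * Suc u) < dyadic (Suc u)" by simp
  then show ?thesis by (simp add: std_order_def inorder_iff u)
qed

lemma omega_eta_std_order: "omega_eta std_order"
proof
  have div: "x = y" if "odd x" "odd y" "x div 2 = y div 2" for x y :: nat
    using that by (auto elim!: oddE)
  have node: "\<exists>x. odd x \<and> Suc (x div 2) = z" if "0 < z" for z
    using that by (intro exI[of _ "2 * z - 1"]) (cases z, auto)
  show "std_order x x" for x by (simp add: std_order_def inorder_refl)
  show "std_order x z" if "std_order x y" "std_order y z" for x y z
    using that by (auto simp: std_order_def inorder_iff)
  show "x = y" if "std_order x y" "std_order y x" for x y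
    using that div[of x y] by (auto simp: std_order_def inorder_iff dest: antisym)
  show "std_order x y \<or> std_order y x" for x y by (auto simp: std_order_def inorder_iff)
  show "infinite (omega_part std_order)"
    unfolding infinite_nat_iff_unbounded
  proof
    fix m :: nat
    show "\<exists>n>m. n \<in> omega_part std_order"
      by (rule exI[of _ "2 * Suc m"]) (simp add: omega_part_std_order)
  qed
  show "\<exists>x. x \<notin> omega_part std_order"
    by (rule exI[of _ 1]) (simp add: omega_part_std_order)
  fix x assume x: "x \<notin> omega_part std_order"
  then show "\<exists>y. y \<notin> omega_part std_order \<and> std_order y x \<and> y \<noteq> x"
    using std_order_left_child[of x] by (intro exI[of _ "Suc (2 * x)"]) (simp add: omega_part_std_order)
  obtain z where z: "z > 0" "dyadic (Suc (x div 2)) < dyadic z" using inorder_no_greatest by blast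
  then obtain y where "odd y" "Suc (y div 2) = z" using node by blast
  with x z show "\<exists>y. std_order x y \<and> y \<noteq> x"
    by (intro exI[of _ y]) (auto simp: omega_part_std_order std_order_def inorder_iff)
  fix y assume y: "y \<notin> omega_part std_order" and xy: "std_order x y" "x \<noteq> y"
  with x div[of x y] have "dyadic (Suc (x div 2)) < dyadic (Suc (y div 2))"
    by (auto simp: omega_part_std_order std_order_def inorder_iff order_less_le)
  then obtain w where w: "w > 0" "dyadic (Suc (x div 2)) < dyadic w" "dyadic w < dyadic (Suc (y div 2))"
    using inorder_dense by blast
  then obtain v where "odd v" "Suc (v div 2) = w" using node by blast
  with x y w show "\<exists>z. std_order x z \<and> std_order z y \<and> z \<noteq> x \<and> z \<noteq> y"
    by (intro exI[of _ v]) (auto simp: omega_part_std_order std_order_def inorder_iff)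
qed


section \<open>Following the path inside the order\<close>

context path_order
begin

text \<open>The alternative \<open>s \<le> t\<close> bounds the search. If y is supported at s with
  index 0, the result is the first stage at which it is, exactly what completes y and 0 to a
  realized number.\<close>

definition stage :: "nat \<Rightarrow> nat \<Rightarrow> nat" where
  "stage s y = (LEAST t. s \<le> t \<or> supported t y 0)"

text \<open>\<open>H\<close> stands for an isomorphism onto the decidable copy, so parity of its values tells the
  $\omega$-part from the $\eta$-part.\<close>

definition next_left :: "(nat \<Rightarrow> nat) \<Rightarrow> nat \<Rightarrow> nat \<Rightarrow> nat \<Rightarrow> nat" where
  "next_left H v w s = (LEAST y. w < y \<or> v < y \<and> (\<exists>i\<le>w. w div 2 ^ i = y) \<and>
     odd (H (pair y (pair 0 (stage s y)))))"

lemma realized_stage: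
  assumes "supported s w j" "w \<in> subtree y" "y > 0"
  shows "realized (pair y (pair 0 (stage s y)))"
proof -
  have "good s y" using assms by (auto simp: supported_def intro: good_ancestor)
  moreover have "y \<le> s" using assms(1) subtree_le[OF assms(2)] by (simp add: supported_def)
  ultimately have sup: "supported s y 0" using inorder_refl by (auto simp: supported_def)
  let ?P = "\<lambda>t. s \<le> t \<or> supported t y 0"
  have "?P (stage s y)" unfolding stage_def by (rule LeastI[of ?P s]) simp
  moreover have "stage s y \<le> s" unfolding stage_def by (rule Least_le) simp
  ultimately have "supported (stage s y) y 0" using sup by auto
  moreover have "\<not> ?P t" if "t < stage s y" for t
    using that unfolding stage_def by (rule not_less_Least)
  ultimately show ?thesis by (simp add: realized_def)
qed

text \<open>A node w right of the path but below \<open>path m\<close> left the path at some left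
  turn M beyond m. So the path nodes up to M are ancestors of w, and among the ancestors beyond
  \<open>path m\<close> the least one right of the path is the next left turn. The stage of w
  supports all its ancestors, so the parity of \<open>H\<close> can be trusted on them. The
  alternative \<open>w < y\<close> bounds the search; the node found is an ancestor of w and hence
  at most w.\<close>

lemma next_left_eq:
  assumes H: "\<And>x. realized x \<Longrightarrow> odd (H x) \<longleftrightarrow> right_of_path (pfst x)"
    and m: "turns_left (path m)"
    and w: "supported s w j" "right_of_path w" "dyadic w < dyadic (path m)"
  shows "\<exists>k>m. turns_left (path k) \<and> (\<forall>l. m < l \<and> l < k \<longrightarrow> \<not> turns_left (path l)) \<and>
    next_left H (path m) w s = path k \<and> realized (pair (path k) (pair 0 (stage s (path k))))"
proof -
  obtain M where M: "turns_left (path M)" "w = path M \<or> w \<in> subtree (Suc (2 * path M))"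
    using w(2) by (auto simp: right_of_path_def)
  then have wM: "w \<in> subtree (path M)" "dyadic (path M) \<le> dyadic w"
    using right_subtree_greater[of w "path M"] path_pos[of M]
    by (auto intro: subtree_refl subtree_of_right_child)
  have "m < M"
  proof (rule ccontr)
    assume "\<not> m < M"
    then consider "M = m" | "M < m" by linarith
    then have "dyadic (path m) \<le> dyadic (path M)"
    proof cases
      case 2
      from path_subtree_less[OF this] M(1) left_subtree_less[of "path m" "path M"] path_pos[of M]
      show ?thesis by simp
    qed simp
    with wM(2) w(3) show False by simp
  qed
  define k where "k = (LEAST k. m < k \<and> turns_left (path k))"
  have k: "m < k \<and> turns_left (path k)"
    unfolding k_def by (rule LeastI[of _ M]) (simp add: \<open>m < M\<close> M(1))
  have "k \<le> M" unfolding k_def by (rule Least_le) (simp add: \<open>m < M\<close> M(1))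
  have min: "\<not> turns_left (path l)" if "m < l" "l < k" for l
    using that not_less_Least[of l "\<lambda>k. m < k \<and> turns_left (path k)"] by (simp add: k_def)
  have wk: "w \<in> subtree (path k)" by (rule subtree_trans[OF path_subtree[OF \<open>k \<le> M\<close>] wM(1)])
  have real: "realized (pair y (pair 0 (stage s y)))" if "w \<in> subtree y" "y > 0" for y
    using realized_stage[OF w(1)] that by blast
  have odd: "odd (H (pair y (pair 0 (stage s y)))) \<longleftrightarrow> right_of_path y" if "w \<in> subtree y" "y > 0" for y
    using H[OF real[OF that]] by simp
  have "next_left H (path m) w s = path k"
    unfolding next_left_def
  proof (rule Least_equality)
    have "path m < path k" using k strict_mono_path by (simp add: strict_mono_less)
    moreover have "\<exists>i\<le>w. w div 2 ^ i = path k" using wk subtree_iff_bounded[OF path_pos] by simp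
    moreover have "right_of_path (path k)" using k by (auto simp: right_of_path_def)
    ultimately show "w < path k \<or> path m < path k \<and> (\<exists>i\<le>w. w div 2 ^ i = path k) \<and>
        odd (H (pair (path k) (pair 0 (stage s (path k)))))"
      using odd[OF wk path_pos] by simp
  next
    fix y
    assume y: "w < y \<or> path m < y \<and> (\<exists>i\<le>w. w div 2 ^ i = y) \<and> odd (H (pair y (pair 0 (stage s y))))"
    show "path k \<le> y"
    proof (rule ccontr)
      assume less: "\<not> path k \<le> y"
      with subtree_le[OF wk] y have y: "path m < y" "\<exists>i\<le>w. w div 2 ^ i = y"
        "odd (H (pair y (pair 0 (stage s y))))" by auto
      then have "y > 0" "w \<in> subtree y" by (auto simp: subtree_def)
      with y(3) odd have r: "right_of_path y" by blast
      from subtree_linear[OF wk \<open>w \<in> subtree y\<close>] less subtree_le[of y "path k"]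
      have "path k \<in> subtree y" by auto
      from ancestor_of_path[OF \<open>y > 0\<close> this] obtain l where l: "y = path l" by blast
      with y(1) less have "m < l" "l < k" using strict_mono_path by (auto simp: strict_mono_less strict_mono_less_eq)
      then have "left_of_path y" using min l by (auto simp: left_of_path_def)
      with r not_left_and_right show False by blast
    qed
  qed
  with k min real[OF wk path_pos] show ?thesis by blast
qed

lemma pr_pred_supported_oracle:
  assumes "pr_fun G a" "pr_fun G b" "pr_fun G c"
  shows "pr_pred G (\<lambda>x. supported (a x) (b x) (c x))"
proof -
  have "pr_pred {} (\<lambda>p. supported (pfst p) (pfst (psnd p)) (psnd (psnd p)))" by (intro pr_intros)
  from pr_pred_comp[OF pr_pred_mono[OF this] pr_fun_pair[OF assms(1) pr_fun_pair[OF assms(2,3)]]]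
  show ?thesis by simp
qed

lemma pr_fun_stage:
  assumes "pr_fun G a" "pr_fun G b"
  shows "pr_fun G (\<lambda>x. stage (a x) (b x))"
  unfolding stage_def
  by (rule pr_fun_Least[where n = a])
    (intro pr_intros pr_pred_supported_oracle pr_fun_comp[OF assms(1)] pr_fun_comp[OF assms(2)] assms | auto)+

lemma pr_fun_next_left:
  assumes "pr_fun G H" "pr_fun G a" "pr_fun G b" "pr_fun G c"
  shows "pr_fun G (\<lambda>x. next_left H (a x) (b x) (c x))"
  unfolding next_left_def
  by (rule pr_fun_Least[where n = "\<lambda>x. Suc (b x)"])
    (intro pr_intros pr_fun_stage pr_fun_comp[OF assms(1)] pr_fun_comp[OF assms(2)]
      pr_fun_comp[OF assms(3)] pr_fun_comp[OF assms(4)] assms | auto)+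

text \<open>\<open>Suc (2 * H x)\<close> is the left child in the decidable copy, so for x in the
  \<eta>-part z is a smaller element of that part. Its node and stage feed the search, and the
  result again has index 0, so the step can be iterated.\<close>

definition follow :: "(nat \<Rightarrow> nat) \<Rightarrow> (nat \<Rightarrow> nat) \<Rightarrow> nat \<Rightarrow> nat" where
  "follow h H x = (let z = h (Suc (2 * H x)); y = next_left H (pfst x) (pfst z) (psnd (psnd z))
     in pair y (pair 0 (stage (psnd (psnd z)) y)))"

lemma pr_fun_follow:
  assumes "pr_fun G h" "pr_fun G H"
  shows "pr_fun G (follow h H)"
proof -
  have "pr_fun G (\<lambda>x. follow h H x)"
    unfolding follow_def Let_def
    by (intro pr_intros pr_fun_stage pr_fun_next_left[OF assms(2)] pr_fun_comp[OF assms(1)] assms(2))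
  then show ?thesis by simp
qed

lemma follow_left_turn:
  assumes iso: "isomorphism std_order order h"
    and x: "realized x" "pfst (psnd x) = 0" "pfst x = path m" "turns_left (path m)"
  shows "\<exists>k>m. turns_left (path k) \<and> (\<forall>l. m < l \<and> l < k \<longrightarrow> \<not> turns_left (path l)) \<and>
    realized (follow h (inv h) x) \<and> pfst (psnd (follow h (inv h) x)) = 0 \<and>
    pfst (follow h (inv h) x) = path k"
proof -
  let ?H = "inv h"
  have isoH: "isomorphism order std_order ?H" by (rule isomorphism_inv[OF iso])
  have hH: "h (?H y) = y" for y using iso by (simp add: isomorphism_def bij_is_surj surj_f_inv_f)
  have H: "odd (?H y) \<longleftrightarrow> right_of_path (pfst y)" if "realized y" for y
    using isomorphism_omega_part[OF isoH, of y] realized_omega_part[OF that]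
    by (simp add: omega_part_std_order)
  define z where "z = h (Suc (2 * ?H x))"
  have "right_of_path (pfst x)" using x(3,4) by (auto simp: right_of_path_def)
  then have "odd (?H x)" using H x(1) by blast
  then have "std_order (Suc (2 * ?H x)) (?H x)" by (rule std_order_left_child)
  then have zx: "order z x"
    using iso hH[of x] unfolding isomorphism_def z_def by metis
  have "z \<notin> omega_part order"
    using isomorphism_omega_part[OF iso, of "Suc (2 * ?H x)"] by (simp add: z_def omega_part_std_order)
  have "z \<noteq> x"
  proof
    assume "z = x"
    then have "h (Suc (2 * ?H x)) = h (?H x)" by (simp add: z_def hH)
    then have "Suc (2 * ?H x) = ?H x" using iso by (simp add: isomorphism_def bij_def inj_eq)
    then show False by simp
  qed
  \<comment> \<open>Realized numbers form an initial segment of \<open>order\<close>.\<close>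
  have z: "realized z" using zx x(1) by (auto simp: order_def split: if_splits)
  then have right: "right_of_path (pfst z)" using \<open>z \<notin> omega_part order\<close> realized_omega_part by blast
  \<comment> \<open>Index 0 is the least in its block, so an element strictly below x lies in a
    smaller block. This is why only elements of index 0 are followed.\<close>
  have "pfst z \<noteq> pfst x"
  proof
    assume eq: "pfst z = pfst x"
    with zx z x(1,2) have "inorder (pfst (psnd z)) 0" by (simp add: order_def block_def)
    then have "pfst (psnd z) = 0"
      using dyadic_pos_ge[of "pfst (psnd z)"] by (cases "pfst (psnd z) = 0") (auto simp: inorder_iff dyadic_0)
    with eq z x(1,2) \<open>z \<noteq> x\<close> realized_unique show False by metis
  qed
  moreover have "inorder (pfst z) (pfst x)"
    using zx z x(1) calculation by (simp add: order_def block_def)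
  ultimately have less: "dyadic (pfst z) < dyadic (path m)"
    using x(3) by (simp add: inorder_iff order_less_le)
  have sup: "supported (psnd (psnd z)) (pfst z) (pfst (psnd z))" using z by (simp add: realized_def)
  from next_left_eq[of ?H, OF H x(4) sup right less] show ?thesis
    unfolding follow_def Let_def z_def[symmetric] x(3) by auto
qed

end


section \<open>Coding a $\Delta^0_3$ function into a path\<close>

text \<open>Below its leading digit, the binary expansion of u spells the way from the root, 0 for
  left and 1 for right; this counts the left turns.\<close>

definition zeros :: "nat \<Rightarrow> nat" where
  "zeros u = (\<Sum>i<floor_log u. of_bool (even (u div 2 ^ i)))"

text \<open>The right turns since the last left turn. Before any left turn the leading digit is
  counted too, so the root has value 1.\<close>

definition trailing_ones :: "nat \<Rightarrow> nat" where
  "trailing_ones u = (LEAST i. even (u div 2 ^ i))"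

lemma zeros_child:
  assumes "u > 0"
  shows "zeros (2 * u) = Suc (zeros u)" "zeros (Suc (2 * u)) = zeros u"
  using assms unfolding zeros_def
  by (simp_all add: floor_log_twice_Suc sum.lessThan_Suc_shift div_mult2_eq del: sum.lessThan_Suc)

lemma trailing_ones_child:
  "trailing_ones (2 * u) = 0" "trailing_ones (Suc (2 * u)) = Suc (trailing_ones u)"
proof -
  show "trailing_ones (2 * u) = 0" unfolding trailing_ones_def by (rule Least_equality) simp_all
  have "Suc u \<le> 2 ^ u" using less_exp[of u] by (rule Suc_leI)
  then have "Suc (2 * u) < 2 ^ Suc u" by simp
  then have "even (Suc (2 * u) div 2 ^ Suc u)" by simp
  from Least_Suc[of "\<lambda>i. even (Suc (2 * u) div 2 ^ i)", OF this]
  show "trailing_ones (Suc (2 * u)) = Suc (trailing_ones u)"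
    by (simp add: trailing_ones_def div_mult2_eq)
qed

lemma pr_fun_zeros [pr_intros]: "pr_fun G a \<Longrightarrow> pr_fun G (\<lambda>x. zeros (a x))"
  by (rule pr_fun_comp) (unfold zeros_def, intro pr_intros)

lemma pr_fun_trailing_ones [pr_intros]:
  assumes "pr_fun G a"
  shows "pr_fun G (\<lambda>x. trailing_ones (a x))"
proof -
  have "\<exists>i\<le>u. even (u div 2 ^ i)" for u :: nat
    by (rule exI[of _ u]) (simp add: less_exp)
  then have "pr_fun G (\<lambda>u. trailing_ones u)"
    unfolding trailing_ones_def by (intro pr_fun_Least[where n = "\<lambda>u. u"] pr_intros)
  from pr_fun_comp[OF this assms] show ?thesis .
qed

lemma path_order_of_delta_fun:
  assumes "delta_fun 3 f"
  obtains R where "path_order R"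
    "\<And>u. tree_path.turns_left R u \<Longrightarrow> f (zeros u) = pfst (trailing_ones u - 1)"
proof -
  obtain Q where Q: "pr_pred {} Q"
    "\<And>n y. f n = y \<longleftrightarrow> (\<exists>a. \<forall>b. \<exists>c. Q (pair c (pair b (pair a (pair n y)))))"
    using delta_fun_3_matrix[OF assms] by blast
  \<comment> \<open>The code is the count minus 1 and a count of 0 is never accepted: counting
    restarts at 0 after a left turn, but begins at 1 at the root. Rejecting 0 also forces a right
    turn after each left turn.\<close>
  define R where "R u b c \<longleftrightarrow> 0 < trailing_ones u \<and>
    Q (pair c (pair b (pair (psnd (trailing_ones u - 1)) (pair (zeros u) (pfst (trailing_ones u - 1))))))" for u b c
  define P where "P n r \<longleftrightarrow> 0 < r \<and> (\<forall>b. \<exists>c. Q (pair c (pair b (pair (psnd (r - 1)) (pair n (pfst (r - 1)))))))" for n r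
  interpret tree_path R .
  have left: "turns_left u \<longleftrightarrow> P (zeros u) (trailing_ones u)" for u
    by (auto simp: turns_left_def R_def P_def)
  have ex: "\<exists>r. P n r" for n
  proof -
    obtain a where "\<forall>b. \<exists>c. Q (pair c (pair b (pair a (pair n (f n)))))" using Q(2) by blast
    then have "P n (Suc (pair (f n) a))" by (simp add: P_def)
    then show ?thesis ..
  qed
  \<comment> \<open>At a path node all smaller counts have been tried in vain, so going right
    forever would pass over a count that \<open>ex\<close> declares successful.\<close>
  have none: "\<not> P (zeros (path m)) r" if "r < trailing_ones (path m)" for m r
    using that
  proof (induction m arbitrary: r)
    case 0
    have "trailing_ones 1 = 1" using trailing_ones_child(2)[of 0] trailing_ones_child(1)[of 0] by simp
    with 0 show ?case by (simp add: P_def)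
  next
    case (Suc m)
    then show ?case
      using left[of "path m"] path_pos[of m]
      by (auto simp: trailing_ones_child zeros_child less_Suc_eq split: if_splits)
  qed
  have "path_order R"
  proof
    show "pr_pred {} (\<lambda>p. R (pfst p) (pfst (psnd p)) (psnd (psnd p)))"
      unfolding R_def by (intro pr_intros pr_pred_comp[OF Q(1)])
    show "\<exists>k>m. turns_left (path k)" for m
    proof (rule ccontr)
      assume no: "\<not> (\<exists>k>m. turns_left (path k))"
      have "zeros (path (Suc m + i)) = zeros (path (Suc m)) \<and>
          trailing_ones (path (Suc m + i)) = trailing_ones (path (Suc m)) + i" for i
      proof (induction i)
        case (Suc i)
        have "m < Suc m + i" by simp
        with no have "\<not> turns_left (path (Suc m + i))" by blast
        then have "path (Suc m + Suc i) = Suc (2 * path (Suc m + i))" by simp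
        with Suc.IH show ?case using path_pos[of "Suc m + i"] by (simp only: trailing_ones_child zeros_child) simp
      qed simp
      note const = this
      obtain r where "P (zeros (path (Suc m))) r" using ex by blast
      with const[of "Suc r"] none[of r "Suc m + Suc r"] show False by simp
    qed
    show "\<exists>k>m. \<not> turns_left (path k)" for m
    proof (cases "turns_left (path (Suc m))")
      case True
      then have "trailing_ones (path (Suc (Suc m))) = 0" by (simp only: path.simps if_True trailing_ones_child)
      then have "\<not> turns_left (path (Suc (Suc m)))" unfolding left by (simp add: P_def)
      then show ?thesis by (intro exI[of _ "Suc (Suc m)"]) simp
    qed auto
  qed
  moreover have "f (zeros u) = pfst (trailing_ones u - 1)" if "turns_left u" for u
    using that unfolding left P_def Q(2) by blast
  ultimately show thesis by (rule that)
qed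

context path_order
begin

lemma zeros_path_const:
  assumes "m < k" "\<And>l. m < l \<Longrightarrow> l < k \<Longrightarrow> \<not> turns_left (path l)"
  shows "zeros (path k) = zeros (path (Suc m))"
  using assms
proof (induction k)
  case (Suc k)
  show ?case
  proof (cases "m = k")
    case False
    with Suc.prems have "m < k" by simp
    with Suc have "zeros (path k) = zeros (path (Suc m))" "\<not> turns_left (path k)" by auto
    then show ?thesis by (simp add: zeros_child path_pos)
  qed simp
qed simp

lemma pr_fun_left_turns:
  assumes "isomorphism std_order order h" "pr_fun G h" "pr_fun G (inv h)"
  obtains F where "pr_fun G F" "\<And>n. turns_left (F n) \<and> zeros (F n) = n"
proof -
  \<comment> \<open>The first left turn and its stage are constants and need not be
    computed.\<close>
  define k0 where "k0 = (LEAST k. turns_left (path k))"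
  have k0: "turns_left (path k0)" unfolding k0_def by (rule LeastI_ex) (use often_left in blast)
  have min: "\<not> turns_left (path l)" if "l < k0" for l
    using that unfolding k0_def by (rule not_less_Least)
  have "zeros (path k) = 0" if "k \<le> k0" for k
    using that
  proof (induction k)
    case (Suc k)
    with min[of k] show ?case by (simp add: zeros_child path_pos)
  qed (simp add: zeros_def)
  then have z0: "zeros (path k0) = 0" by simp
  obtain t where t: "realized (pair (path k0) (pair 0 t))" using realized_path by blast
  define X where "X n = rec_nat (pair (path k0) (pair 0 t)) (\<lambda>_ x. follow h (inv h) x) n" for n
  have X: "realized (X n) \<and> pfst (psnd (X n)) = 0 \<and>
      (\<exists>m. pfst (X n) = path m \<and> turns_left (path m) \<and> zeros (path m) = n)" for n
  proof (induction n)
    case 0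
    then show ?case using t k0 z0 by (auto simp: X_def)
  next
    case (Suc n)
    then obtain m where m: "realized (X n)" "pfst (psnd (X n)) = 0" "pfst (X n) = path m"
      "turns_left (path m)" "zeros (path m) = n" by blast
    from follow_left_turn[OF assms(1) m(1-4)] obtain k where k: "m < k" "turns_left (path k)"
      "\<And>l. m < l \<Longrightarrow> l < k \<Longrightarrow> \<not> turns_left (path l)"
      "realized (X (Suc n))" "pfst (psnd (X (Suc n))) = 0" "pfst (X (Suc n)) = path k"
      by (auto simp: X_def)
    \<comment> \<open>Only the left turn at m raises the count, and the right turns up to k keep it;
      so no argument of f is skipped.\<close>
    have "zeros (path k) = zeros (path (Suc m))" by (rule zeros_path_const[OF k(1,3)])
    also have "\<dots> = Suc n" using m(4,5) by (simp add: zeros_child path_pos)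
    finally show ?case using k by blast
  qed
  have "pr_fun G (\<lambda>n. pfst (X n))"
    unfolding X_def by (intro pr_intros pr_fun_comp[OF pr_fun_follow[OF assms(2,3)]])
  moreover have "turns_left (pfst (X n)) \<and> zeros (pfst (X n)) = n" for n
    using X[of n] by auto
  ultimately show thesis by (rule that)
qed

end

lemma pr_le_degree_class: "pr_le_degree f (pr_equiv `` {g}) \<longleftrightarrow> f \<le>\<^sub>P\<^sub>R g"
  unfolding pr_le_degree_def pr_equiv_def using pr_le_trans pr_le_refl by blast

text \<open>A degree in \<open>PrCat A\<close> serves all punctual copies, in particular the
  decidable one and the one built for f. The isomorphism between these two is composed through A, so
  nothing about A itself has to be decided.\<close>

lemma PrCat_subset_Cone_Delta:
  assumes "A \<cong> omega_plus_eta"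
  shows "PrCat A \<subseteq> Cone_Delta 3"
proof
  fix d assume d: "d \<in> PrCat A"
  then have "d \<in> pr_degrees" by (simp add: PrCat_def)
  then obtain g where g: "d = pr_equiv `` {g}" by (auto simp: pr_degrees_def quotient_def)
  have cat: "\<exists>h. isomorphism A B h \<and> pr_fun {g} h \<and> pr_fun {g} (inv h)"
    if "punctual B" "omega_eta B" for B
  proof -
    note B = that
    have "B \<cong> omega_plus_eta" using B(2) by (simp add: isomorphic_omega_plus_eta_iff)
    with assms have "A \<cong> B" using isomorphism_comp isomorphism_inv unfolding isomorphic_def by blast
    with B(1) d show ?thesis
      by (auto simp: PrCat_def g pr_le_degree_class pr_le_iff_pr_fun)
  qed
  have "pr_le_degree f d" if f: "delta_fun 3 f" for f
  proof -
    obtain R where "path_order R"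
      and R: "\<And>u. tree_path.turns_left R u \<Longrightarrow> f (zeros u) = pfst (trailing_ones u - 1)"
      using path_order_of_delta_fun[OF f] by blast
    interpret path_order R by fact
    obtain h0 where h0: "isomorphism A std_order h0" "pr_fun {g} h0" "pr_fun {g} (inv h0)"
      using cat[OF punctual_std_order omega_eta_std_order] by blast
    obtain h1 where h1: "isomorphism A order h1" "pr_fun {g} h1" "pr_fun {g} (inv h1)"
      using cat[OF punctual_order omega_eta_order] by blast
    define h where "h = h1 \<circ> inv h0"
    have iso: "isomorphism std_order order h"
      unfolding h_def by (rule isomorphism_comp[OF isomorphism_inv[OF h0(1)] h1(1)])
    have "pr_fun {g} h"
      unfolding h_def comp_def by (rule pr_fun_comp[OF h1(2) h0(3)])
    moreover have "inv h = h0 \<circ> inv h1"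
      using h0(1) h1(1) unfolding h_def isomorphism_def
      by (simp add: o_inv_distrib bij_imp_bij_inv inv_inv_eq)
    then have "pr_fun {g} (inv h)"
      using pr_fun_comp[OF h0(2) h1(3)] by (simp add: comp_def)
    ultimately obtain F where F: "pr_fun {g} F" "\<And>n. turns_left (F n) \<and> zeros (F n) = n"
      using pr_fun_left_turns[OF iso] by blast
    have "f = (\<lambda>n. pfst (trailing_ones (F n) - 1))"
      using R F(2) by (metis (no_types))
    moreover have "pr_fun {g} (\<lambda>n. pfst (trailing_ones (F n) - 1))"
      by (intro pr_intros F(1))
    ultimately show ?thesis by (simp add: g pr_le_degree_class pr_le_iff_pr_fun)
  qed
  with \<open>d \<in> pr_degrees\<close> show "d \<in> Cone_Delta 3" by (simp add: Cone_Delta_def)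
qed

text \<open>\<open>std_order\<close> provides the punctual copy, and the quantifier over A covers
  the independence of the choice of copy.\<close>

theorem theorem3p8:
  "(\<exists>A :: nat \<Rightarrow> nat \<Rightarrow> bool. punctual A \<and> A \<cong> omega_plus_eta) \<and>
   (\<forall>A :: nat \<Rightarrow> nat \<Rightarrow> bool. punctual A \<and> A \<cong> omega_plus_eta \<longrightarrow> PrCat A = Cone_Delta 3)"
  using punctual_std_order omega_eta_std_order PrCat_subset_Cone_Delta Cone_Delta_subset_PrCat
    isomorphic_omega_plus_eta_iff by blast

end
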